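(* Let $H$ be a Hilbert space and let $A$ be a self-adjoint operator in $H$ with partition of unity $E_t$, $t\in\mathbb{R}$. Let $\varphi,\psi:\mathbb{R}\to\mathbb{C}$ be continuous functions such that $|\varphi|$ and $|\psi|$ are even and strictly increasing to $+\infty$ on $(0,+\infty)$, and suppose that $|\varphi(t)|^2=F(|\psi(t)|^2)$, where $F$ is a strictly increasing, concave function with $F(0)=0$. Suppose that $(E_t-E_s)D(\psi(A))\ne\{\theta\}$ for all $0\le s<t\le\infty$. Let $\mathcal{R}$ be any one of the following: the set $\mathcal{O}$ of all mappings $H\to H$, the set $\mathcal{B}$ of all bounded linear operators $H\to H$, or the set $\mathcal{L}$ of all linear operators $H\to H$. Then for every given error $\delta>0$ $$\mathcal{E}_\delta(\mathcal{R};\varphi(A),W^\psi)=\omega(\delta)=\delta\sqrt{F\left(\frac1{\delta^2}\right)},$$ where $\omega(\delta)=\sup\{\|\varphi(A)x\|:x\in W^\psi,\ \|x\|\le\delta\}$ is the modulus of continuity of the operator $\varphi(A)$ on the class $W^\psi$.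
   Context: $\theta$ denotes the zero element of $H$. The partition of unity (spectral family) $E_t$ of $A$ is the family of projections with $E_uE_v=E_{\min\{u,v\}}$, strongly left-continuous ($E_{t-0}=E_t$), $E_{-\infty}=0$, $E_{\infty}=I$ (strong limits), and $A=\int_{-\infty}^{+\infty}t\,dE_t$. For a function $f$ on $\mathbb{R}$ (measurable and finite almost everywhere with respect to $E_t$), $D(f(A))=\{x\in H:\int_{-\infty}^{+\infty}|f(t)|^2\,d(E_tx,x)<\infty\}$ and $f(A)x=\int_{-\infty}^{+\infty}f(t)\,dE_tx$ for $x\in D(f(A))$. The class $W^\psi$ is $\{x\in D(\psi(A)):\|\psi(A)x\|\le1\}$. The error of optimal recovery of $\varphi(A)$ with the help of the set of mappings $\mathcal{R}$ on elements of $W^\psi$ given with error $\delta$ is $$\mathcal{E}_\delta(\mathcal{R};\varphi(A),W^\psi)=\inf_{T\in\mathcal{R}}\ \sup\{\|\varphi(A)x-T\eta\|: x\in W^\psi,\ \eta\in H,\ \|x-\eta\|\le\delta\}.$$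
   Formalization: The formal theorem adds the condition |ψ(0)|·δ ≤ 1 (automatic if ψ(0)=0); without it the formula fails, e.g. for multiplication by t on L²(ℝ) with ψ=√(1+t²), φ=(1+t²)^{1/4}, F(u)=√u and δ>1. *)

theory Defs
  imports "HOL-Analysis.Analysis"
begin

section \<open>Complex Hilbert spaces\<close>

text \<open>
  A complex inner product space, built on top of \<^class>\<open>real_inner\<close>: the underlying real
  inner product is the real part of the complex one, so norm, topology and completeness are
  the library's. Positive definiteness of \<open>cinner\<close> is inherited from \<^class>\<open>real_inner\<close>.
  The complex inner product is linear in its first argument.
  A Hilbert space is a type of sort \<open>{complex_inner, complete_space}\<close>.
\<close>

class complex_inner = real_inner +
  fixes scaleC :: "complex \<Rightarrow> 'a \<Rightarrow> 'a"  (infixr \<open>*\<^sub>C\<close> 75)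
    and cinner :: "'a \<Rightarrow> 'a \<Rightarrow> complex"
  assumes scaleC_add_right: "a *\<^sub>C (x + y) = a *\<^sub>C x + a *\<^sub>C y"
    and scaleC_add_left: "(a + b) *\<^sub>C x = a *\<^sub>C x + b *\<^sub>C x"
    and scaleC_scaleC: "a *\<^sub>C (b *\<^sub>C x) = (a * b) *\<^sub>C x"
    and scaleR_scaleC: "r *\<^sub>R x = complex_of_real r *\<^sub>C x"
    and cinner_commute: "cinner x y = cnj (cinner y x)"
    and cinner_add_left: "cinner (x + y) z = cinner x z + cinner y z"
    and cinner_scaleC_left: "cinner (a *\<^sub>C x) y = a * cinner x y"
    and inner_eq_Re_cinner: "inner x y = Re (cinner x y)"

global_interpretation complex_vector: vector_space "scaleC :: complex \<Rightarrow> 'a \<Rightarrow> 'a::complex_inner"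
proof
  fix x :: 'a
  show "1 *\<^sub>C x = x"
    using scaleR_scaleC[of 1 x] by simp
qed (simp_all add: scaleC_add_right scaleC_add_left scaleC_scaleC)

abbreviation clinear :: "('a::complex_inner \<Rightarrow> 'b::complex_inner) \<Rightarrow> bool" where
  "clinear \<equiv> Vector_Spaces.linear scaleC scaleC"


section \<open>Self-adjoint operators\<close>

text \<open>
  An operator is a function together with its domain \<open>D\<close>; its values outside \<open>D\<close> are
  irrelevant.
\<close>

definition linear_operator_on :: "'a::complex_inner set \<Rightarrow> ('a \<Rightarrow> 'a) \<Rightarrow> bool" where
  "linear_operator_on D A \<longleftrightarrow> complex_vector.subspace D \<and>
     (\<forall>x\<in>D. \<forall>y\<in>D. A (x + y) = A x + A y) \<and> (\<forall>c. \<forall>x\<in>D. A (c *\<^sub>C x) = c *\<^sub>C A x)"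

definition adjoint_graph :: "'a::complex_inner set \<Rightarrow> ('a \<Rightarrow> 'a) \<Rightarrow> ('a \<times> 'a) set" where
  "adjoint_graph D A = {(y, z). \<forall>x\<in>D. cinner (A x) y = cinner x z}"

definition self_adjoint_on :: "'a::complex_inner set \<Rightarrow> ('a \<Rightarrow> 'a) \<Rightarrow> bool" where
  "self_adjoint_on D A \<longleftrightarrow> linear_operator_on D A \<and> closure D = UNIV \<and>
     adjoint_graph D A = (\<lambda>x. (x, A x)) ` D"


section \<open>Spectral families and functions of an operator\<close>

definition orthogonal_projection :: "('a::complex_inner \<Rightarrow> 'a) \<Rightarrow> bool" where
  "orthogonal_projection P \<longleftrightarrow> clinear P \<and> (\<forall>x. P (P x) = P x) \<and>
     (\<forall>x y. cinner (P x) y = cinner x (P y))"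

definition spectral_family :: "(real \<Rightarrow> 'a::complex_inner \<Rightarrow> 'a) \<Rightarrow> bool" where
  "spectral_family E \<longleftrightarrow>
     (\<forall>t. orthogonal_projection (E t)) \<and>
     (\<forall>u v x. E u (E v x) = E (min u v) x) \<and>
     (\<forall>t x. ((\<lambda>s. E s x) \<longlongrightarrow> E t x) (at_left t)) \<and>
     (\<forall>x. ((\<lambda>t. E t x) \<longlongrightarrow> 0) at_bot) \<and>
     (\<forall>x. ((\<lambda>t. E t x) \<longlongrightarrow> x) at_top)"

definition ext_family :: "(real \<Rightarrow> 'a::complex_inner \<Rightarrow> 'a) \<Rightarrow> ereal \<Rightarrow> 'a \<Rightarrow> 'a" where
  "ext_family E t x = (if t = \<infinity> then x else if t = -\<infinity> then 0 else E (real_of_ereal t) x)"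

text \<open>
  The Lebesgue-Stieltjes measure \<open>d(E\<^sub>t x, x)\<close>. As \<open>E\<close> is left-continuous, this measure gives
  \<open>{a..<b}\<close> the mass \<open>(E\<^sub>b x, x) - (E\<^sub>a x, x)\<close>. The library's \<^const>\<open>interval_measure\<close> expects a
  right-continuous distribution function (the mass of \<open>{a<..b}\<close> being the increment), hence
  the passage to right limits.
\<close>

definition spectral_measure :: "(real \<Rightarrow> 'a::complex_inner \<Rightarrow> 'a) \<Rightarrow> 'a \<Rightarrow> real measure" where
  "spectral_measure E x =
     interval_measure (\<lambda>t. Lim (at_right t) (\<lambda>s. Re (cinner (E s x) x)))"

text \<open>
  A step function is represented by a list of triples \<open>(c, a, b)\<close> with \<open>a \<le> b\<close>, standing for
  the sum of the functions \<open>c \<cdot> 1\<close> on \<open>{a..<b}\<close>. Its integral against \<open>dE\<^sub>t x\<close> is the sum of the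
  \<open>c (E\<^sub>b - E\<^sub>a) x\<close>; the integral of a general function is the limit in \<open>H\<close> along step functions
  that approximate it in the mean square with respect to \<open>d(E\<^sub>t x, x)\<close>.
\<close>

type_synonym step = "(complex \<times> real \<times> real) list"

definition valid_step :: "step \<Rightarrow> bool" where
  "valid_step L \<longleftrightarrow> (\<forall>(c, a, b)\<in>set L. a \<le> b)"

definition step_fun :: "step \<Rightarrow> real \<Rightarrow> complex" where
  "step_fun L t = (\<Sum>(c, a, b)\<leftarrow>L. if t \<in> {a..<b} then c else 0)"

definition step_integral :: "(real \<Rightarrow> 'a::complex_inner \<Rightarrow> 'a) \<Rightarrow> step \<Rightarrow> 'a \<Rightarrow> 'a" where
  "step_integral E L x = (\<Sum>(c, a, b)\<leftarrow>L. c *\<^sub>C (E b x - E a x))"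

definition has_spectral_integral ::
    "(real \<Rightarrow> 'a::complex_inner \<Rightarrow> 'a) \<Rightarrow> (real \<Rightarrow> complex) \<Rightarrow> 'a \<Rightarrow> 'a \<Rightarrow> bool" where
  "has_spectral_integral E f x v \<longleftrightarrow>
     (\<exists>L :: nat \<Rightarrow> step. (\<forall>n. valid_step (L n)) \<and>
        (\<lambda>n. \<integral>\<^sup>+ t. ennreal ((cmod (f t - step_fun (L n) t))\<^sup>2) \<partial>spectral_measure E x)
          \<longlonglongrightarrow> 0 \<and>
        (\<lambda>n. step_integral E (L n) x) \<longlonglongrightarrow> v)"

definition spectral_dom ::
    "(real \<Rightarrow> 'a::complex_inner \<Rightarrow> 'a) \<Rightarrow> (real \<Rightarrow> complex) \<Rightarrow> 'a set" where
  "spectral_dom E f =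
     {x. (\<integral>\<^sup>+ t. ennreal ((cmod (f t))\<^sup>2) \<partial>spectral_measure E x) < \<infinity>}"

text \<open>
  The operator \<open>f(A)\<close>, where \<open>A\<close> is the operator with spectral family \<open>E\<close>. It is meant for
  Borel functions \<open>f\<close> and for arguments in \<^term>\<open>spectral_dom E f\<close>.
\<close>

definition spectral_op ::
    "(real \<Rightarrow> 'a::complex_inner \<Rightarrow> 'a) \<Rightarrow> (real \<Rightarrow> complex) \<Rightarrow> 'a \<Rightarrow> 'a" where
  "spectral_op E f x = (THE v. has_spectral_integral E f x v)"

definition partition_of_unity_of ::
    "(real \<Rightarrow> 'a::complex_inner \<Rightarrow> 'a) \<Rightarrow> 'a set \<Rightarrow> ('a \<Rightarrow> 'a) \<Rightarrow> bool" where
  "partition_of_unity_of E D A \<longleftrightarrow> spectral_family E \<and>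
     D = spectral_dom E complex_of_real \<and> (\<forall>x\<in>D. A x = spectral_op E complex_of_real x)"


section \<open>Optimal recovery\<close>

definition W_class :: "(real \<Rightarrow> 'a::complex_inner \<Rightarrow> 'a) \<Rightarrow> (real \<Rightarrow> complex) \<Rightarrow> 'a set" where
  "W_class E \<psi> = {x \<in> spectral_dom E \<psi>. norm (spectral_op E \<psi> x) \<le> 1}"

text \<open>
  Both quantities below are taken in the extended reals, since the supremum for a single
  recovery map may be infinite.
\<close>

definition recovery_error ::
    "real \<Rightarrow> ('a::real_normed_vector \<Rightarrow> 'a) set \<Rightarrow> ('a \<Rightarrow> 'a) \<Rightarrow> 'a set \<Rightarrow> ereal" where
  "recovery_error \<delta> R S W =
     (INF T\<in>R. SUP (x, \<eta>)\<in>{(x, \<eta>). x \<in> W \<and> norm (x - \<eta>) \<le> \<delta>}. ereal (norm (S x - T \<eta>)))"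

definition modulus_of_continuity ::
    "('a::real_normed_vector \<Rightarrow> 'a) \<Rightarrow> 'a set \<Rightarrow> real \<Rightarrow> ereal" where
  "modulus_of_continuity S W \<delta> = (SUP x\<in>{x \<in> W. norm x \<le> \<delta>}. ereal (norm (S x)))"

definition all_mappings :: "('a \<Rightarrow> 'a) set" where
  "all_mappings = UNIV"

definition linear_operators :: "('a::complex_inner \<Rightarrow> 'a) set" where
  "linear_operators = {T. clinear T}"

definition bounded_operators :: "('a::complex_inner \<Rightarrow> 'a) set" where
  "bounded_operators = {T. clinear T \<and> bounded_linear T}"

end

theory Submission
  imports Defs
begin

text \<open>
  Put \<open>y\<^sub>0 = 1 / \<delta>\<^sup>2\<close>. A concave function lies below a supporting line at \<open>y\<^sub>0\<close>: there is \<open>k \<ge> 0\<close> such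
  that, with \<open>a = F y\<^sub>0 - k y\<^sub>0\<close>, one has \<open>F y \<le> a + k y\<close> for all \<open>y \<ge> 0\<close>, and \<open>a \<ge> 0\<close> because
  \<open>F 0 = 0\<close> (lemma \<open>concave_supporting_line\<close>). Hence \<open>|\<phi>|\<^sup>2 \<le> a + k |\<psi>|\<^sup>2\<close> everywhere.

  Upper bound of the error. Recover by \<open>T = g(A)\<close> with the bounded function
  \<open>g = \<phi> a / (a + k |\<psi>|\<^sup>2)\<close>. Writing \<open>u = x - \<eta>\<close>, the error is
  \<open>\<phi>(A) x - g(A) \<eta> = (\<phi> - g)(A) x + g(A) u\<close>, and \<open>g\<close> is chosen such that, by the Cauchy-Schwarz
  inequality for a two-term sum with weights \<open>k |\<psi>|\<^sup>2\<close> and \<open>a\<close>, its square is at most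
  \<open>k \<parallel>\<psi>(A) x\<parallel>\<^sup>2 + a \<parallel>u\<parallel>\<^sup>2\<close> (lemma \<open>recovery_estimate\<close>). This is at most \<open>k + a \<delta>\<^sup>2 = \<delta>\<^sup>2 F y\<^sub>0\<close>.
  As \<open>T\<close> is bounded and linear, the bound holds for each of the three classes of mappings.

  Comparison with the modulus. For \<open>x\<close> in the class with \<open>\<parallel>x\<parallel> \<le> \<delta>\<close>, both \<open>x\<close> and \<open>- x\<close> may be
  observed as \<open>0\<close>, so no mapping has an error below \<open>\<parallel>\<phi>(A) x\<parallel>\<close> (lemma
  \<open>modulus_le_recovery_error\<close>).

  Lower bound of the modulus. Choose \<open>t\<^sub>0 \<ge> 0\<close> with \<open>|\<psi>(t\<^sub>0)| = 1 / \<delta>\<close>. For \<open>t > t\<^sub>0\<close> there is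
  \<open>x\<close> in the range of \<open>E\<^sub>t - E\<^sub>t\<^sub>0\<close> of norm \<open>1 / |\<psi>(t)|\<close>. Its spectral measure lives on
  \<open>[t\<^sub>0, t)\<close>, so it is admissible and \<open>\<parallel>\<phi>(A) x\<parallel> \<ge> |\<phi>(t\<^sub>0)| / |\<psi>(t)|\<close>, which tends to
  \<open>\<delta> |\<phi>(t\<^sub>0)| = \<delta> \<surd>(F y\<^sub>0)\<close> as \<open>t\<close> decreases to \<open>t\<^sub>0\<close>.

  These arguments need that \<open>f(A) x\<close> exists and is linear in \<open>x\<close>, with
  \<open>\<parallel>f(A) x\<parallel>\<^sup>2 = \<integral>|f(t)|\<^sup>2 d(E\<^sub>t x, x)\<close>, for continuous \<open>f\<close>. The integral of step functions is an
  isometry (lemma \<open>norm_step_integral\<close>), which makes the integral unique. For continuous \<open>f\<close> one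
  explicit sequence of step functions, obtained by sampling \<open>f\<close> on \<open>[-n, n)\<close>, works for all
  \<open>x\<close> in the domain at once; linearity is then inherited from the step functions. Moreover, several
  functions can be sampled at the same nodes, which reduces \<open>recovery_estimate\<close> to a pointwise
  inequality for each of finitely many mutually orthogonal increments of \<open>E\<close>.
\<close>


section \<open>Complex inner products and orthogonal projections\<close>

lemma cinner_add_right: "cinner x (y + z) = cinner x y + cinner x z"
  using cinner_commute[of x "y + z"] cinner_commute[of x y] cinner_commute[of x z]
  by (simp add: cinner_add_left)

lemma cinner_scaleC_right: "cinner x (c *\<^sub>C y) = cnj c * cinner x y"
  using cinner_commute[of x "c *\<^sub>C y"] cinner_commute[of x y] by (simp add: cinner_scaleC_left)

lemma cinner_zero_left [simp]: "cinner 0 x = 0"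
  using cinner_add_left[of 0 0 x] by simp

lemma cinner_zero_right [simp]: "cinner x 0 = 0"
  using cinner_add_right[of x 0 0] by simp

lemma cinner_diff_left: "cinner (x - y) z = cinner x z - cinner y z"
  using cinner_add_left[of "x - y" y z] by simp

lemma cinner_diff_right: "cinner x (y - z) = cinner x y - cinner x z"
  using cinner_add_right[of x "y - z" z] by simp

lemma cinner_self: "cinner x x = complex_of_real ((norm x)\<^sup>2)"
proof (rule complex_eqI)
  show "Re (cinner x x) = Re (complex_of_real ((norm x)\<^sup>2))"
    by (simp add: inner_eq_Re_cinner[symmetric] power2_norm_eq_inner)
  have "Im (cinner x x) = - Im (cinner x x)"
    using arg_cong[OF cinner_commute[of x x], of Im] by simp
  then show "Im (cinner x x) = Im (complex_of_real ((norm x)\<^sup>2))"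
    by simp
qed

lemma norm_scaleC: "norm (c *\<^sub>C x) = cmod c * norm x"
proof -
  have "complex_of_real ((norm (c *\<^sub>C x))\<^sup>2) = (c * cnj c) * cinner x x"
    by (simp only: cinner_self[symmetric] cinner_scaleC_left cinner_scaleC_right mult.assoc
        mult.left_commute[of c])
  also have "\<dots> = complex_of_real ((cmod c * norm x)\<^sup>2)"
    by (simp only: cinner_self complex_norm_square[symmetric] of_real_mult[symmetric]
        power_mult_distrib)
  finally have "(norm (c *\<^sub>C x))\<^sup>2 = (cmod c * norm x)\<^sup>2"
    by (simp only: of_real_eq_iff)
  then show ?thesis
    by simp
qed

lemma tendsto_scaleC:
  fixes y :: "'a::complex_inner"
  assumes "(f \<longlongrightarrow> y) G"
  shows "((\<lambda>i. c *\<^sub>C f i) \<longlongrightarrow> c *\<^sub>C y) G"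
proof -
  have "bounded_linear (\<lambda>x::'a. c *\<^sub>C x)"
  proof (rule bounded_linear_intro)
    fix r and x y :: 'a
    show "c *\<^sub>C (x + y) = c *\<^sub>C x + c *\<^sub>C y"
      by (rule scaleC_add_right)
    show "c *\<^sub>C (r *\<^sub>R x) = r *\<^sub>R (c *\<^sub>C x)"
      by (simp add: scaleR_scaleC scaleC_scaleC mult.commute)
    show "norm (c *\<^sub>C x) \<le> norm x * cmod c"
      by (simp add: norm_scaleC)
  qed
  then show ?thesis
    using assms by (rule bounded_linear.tendsto)
qed

lemma projection_add: "orthogonal_projection P \<Longrightarrow> P (x + y) = P x + P y"
  by (simp add: orthogonal_projection_def Vector_Spaces.linear_iff)

lemma projection_scaleC: "orthogonal_projection P \<Longrightarrow> P (c *\<^sub>C x) = c *\<^sub>C P x"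
  by (simp add: orthogonal_projection_def Vector_Spaces.linear_iff)

lemma projection_diff: "orthogonal_projection P \<Longrightarrow> P (x - y) = P x - P y"
  using projection_add[of P "x - y" y] by simp


section \<open>Step functions\<close>

lemma step_fun_Nil [simp]: "step_fun [] t = 0"
  by (simp add: step_fun_def)

lemma step_fun_Cons: "step_fun ((c, a, b) # L) t = c * indicator {a..<b} t + step_fun L t"
  by (simp add: step_fun_def indicator_def)

lemma step_fun_measurable [measurable]: "step_fun L \<in> borel_measurable borel"
proof (induction L)
  case Nil
  then show ?case
    by (simp add: step_fun_def[abs_def])
next
  case (Cons p L)
  obtain c a b where p: "p = (c, a, b)"
    by (cases p)
  have "step_fun (p # L) = (\<lambda>t. c * indicator {a..<b} t + step_fun L t)"
    by (simp add: p step_fun_Cons fun_eq_iff)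
  with Cons show ?case
    by simp
qed

lemma step_fun_bounded: "\<exists>B. \<forall>t. cmod (step_fun L t) \<le> B"
proof (induction L)
  case Nil
  then show ?case
    by (intro exI[of _ 0]) simp
next
  case (Cons p L)
  obtain c a b where p: "p = (c, a, b)"
    by (cases p)
  from Cons obtain B where B: "\<And>t. cmod (step_fun L t) \<le> B"
    by blast
  have "cmod (step_fun (p # L) t) \<le> cmod c + B" for t
  proof -
    have "cmod (c * indicator {a..<b} t) \<le> cmod c"
      by (simp add: norm_mult indicator_def)
    then show ?thesis
      using B[of t] norm_triangle_mono unfolding p step_fun_Cons by blast
  qed
  then show ?case
    by blast
qed

lemma valid_step_Cons: "valid_step ((c, a, b) # L) \<longleftrightarrow> a \<le> b \<and> valid_step L"
  by (simp add: valid_step_def)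

lemma step_fun_single: "step_fun [(c, a, b)] t = c * indicator {a..<b} t"
  by (simp add: step_fun_Cons)

definition step_diff :: "step \<Rightarrow> step \<Rightarrow> step" where
  "step_diff L K = L @ map (\<lambda>(c, a, b). (- c, a, b)) K"

lemma valid_step_diff: "valid_step L \<Longrightarrow> valid_step K \<Longrightarrow> valid_step (step_diff L K)"
  by (auto simp: valid_step_def step_diff_def)

lemma step_fun_diff: "step_fun (step_diff L K) t = step_fun L t - step_fun K t"
proof -
  have "step_fun (map (\<lambda>(c, a, b). (- c, a, b)) K) t = - step_fun K t"
    by (induction K) (auto simp: step_fun_Cons)
  then show ?thesis
    by (simp add: step_diff_def step_fun_def)
qed


section \<open>Sampling a continuous function\<close>

definition node :: "nat \<Rightarrow> nat \<Rightarrow> nat \<Rightarrow> real" where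
  "node n m i = real i / real m - real n"

text \<open>
  The nodes subdivide \<open>[-n, n)\<close> with step \<open>1 / m\<close>; on each cell the function is replaced by
  its value at the left end, and outside \<open>[-n, n)\<close> by \<open>0\<close>.
\<close>

definition sample :: "(real \<Rightarrow> complex) \<Rightarrow> nat \<Rightarrow> nat \<Rightarrow> step" where
  "sample f n m = map (\<lambda>i. (f (node n m i), node n m i, node n m (Suc i))) [0..<2 * n * m]"

definition node_below :: "nat \<Rightarrow> nat \<Rightarrow> real \<Rightarrow> real" where
  "node_below n m t = node n m (nat \<lfloor>(t + real n) * real m\<rfloor>)"

lemma node_mono: "i \<le> j \<Longrightarrow> node n m i \<le> node n m j"
  by (simp add: node_def divide_right_mono)

lemma valid_sample: "valid_step (sample f n m)"
  by (auto simp: valid_step_def sample_def node_mono)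

lemma step_integral_sample:
  "step_integral E (sample f n m) x
    = (\<Sum>i<2 * n * m. f (node n m i) *\<^sub>C (E (node n m (Suc i)) x - E (node n m i) x))"
  by (simp add: step_integral_def sample_def comp_def interv_sum_list_conv_sum_set_nat atLeast0LessThan)

lemma node_interval_iff:
  assumes "0 < m"
  shows "t \<in> {node n m i..<node n m (Suc i)} \<longleftrightarrow> - real n \<le> t \<and> i = nat \<lfloor>(t + real n) * real m\<rfloor>"
proof -
  have "t \<in> {node n m i..<node n m (Suc i)}
      \<longleftrightarrow> real i \<le> (t + real n) * real m \<and> (t + real n) * real m < real i + 1"
    using assms by (auto simp: node_def field_simps)
  also have "\<dots> \<longleftrightarrow> \<lfloor>(t + real n) * real m\<rfloor> = int i"
    by (auto simp: floor_eq_iff)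
  also have "\<dots> \<longleftrightarrow> 0 \<le> (t + real n) * real m \<and> i = nat \<lfloor>(t + real n) * real m\<rfloor>"
    unfolding zero_le_floor[symmetric] by (auto simp del: zero_le_floor)
  also have "0 \<le> (t + real n) * real m \<longleftrightarrow> - real n \<le> t"
    using assms by (auto simp: zero_le_mult_iff)
  finally show ?thesis .
qed

lemma step_fun_sample:
  assumes "0 < m"
  shows "step_fun (sample f n m) t = (if t \<in> {- real n..<real n} then f (node_below n m t) else 0)"
proof -
  let ?j = "nat \<lfloor>(t + real n) * real m\<rfloor>"
  have "step_fun (sample f n m) t
      = (\<Sum>i<2 * n * m. if t \<in> {node n m i..<node n m (Suc i)} then f (node n m i) else 0)"
    by (simp only: step_fun_def sample_def map_map comp_def prod.case
        interv_sum_list_conv_sum_set_nat atLeast0LessThan)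
      (simp add: interv_sum_list_conv_sum_set_nat atLeast0LessThan)
  also have "\<dots> = (\<Sum>i<2 * n * m. if i = ?j then (if - real n \<le> t then f (node_below n m t) else 0) else 0)"
    by (intro sum.cong) (simp_all only: node_interval_iff[OF assms] node_below_def, auto)
  also have "\<dots> = (if ?j < 2 * n * m \<and> - real n \<le> t then f (node_below n m t) else 0)"
    by (simp add: sum.delta)
  also have "?j < 2 * n * m \<and> - real n \<le> t \<longleftrightarrow> t \<in> {- real n..<real n}"
  proof (cases "- real n \<le> t")
    case True
    then have "0 \<le> (t + real n) * real m"
      by simp
    then have "?j < 2 * n * m \<longleftrightarrow> (t + real n) * real m < real (2 * n * m)"
      by (simp add: nat_less_iff floor_less_iff)
    also have "\<dots> \<longleftrightarrow> t + real n < 2 * real n"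
      using assms by simp
    finally show ?thesis
      using True by auto
  qed auto
  finally show ?thesis .
qed

lemma node_below_close:
  assumes "0 < m" and "- real n \<le> t"
  shows "node_below n m t \<le> t" and "t < node_below n m t + 1 / real m"
    and "- real n \<le> node_below n m t"
proof -
  have *: "t \<in> {node n m (nat \<lfloor>(t + real n) * real m\<rfloor>)..<node n m (Suc (nat \<lfloor>(t + real n) * real m\<rfloor>))}"
    using node_interval_iff[OF assms(1)] assms(2) by blast
  then show "node_below n m t \<le> t"
    by (simp add: node_below_def)
  show "t < node_below n m t + 1 / real m"
    using * by (simp add: node_below_def node_def add_divide_distrib)
  show "- real n \<le> node_below n m t"
    by (simp add: node_below_def node_def)
qed

text \<open>
  The tolerance \<open>1 / (n + 1)\<close> tends to \<open>0\<close> and never exceeds \<open>1\<close>: the first gives pointwise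
  convergence of the samples, the second a bound that dominates them. The values are in an
  arbitrary metric space so that a tuple of functions can share one mesh.
\<close>

definition fine_mesh :: "(real \<Rightarrow> 'b::metric_space) \<Rightarrow> (nat \<Rightarrow> nat) \<Rightarrow> bool" where
  "fine_mesh f m \<longleftrightarrow> (\<forall>n. 0 < m n \<and>
    (\<forall>t\<in>{- real n..<real n}. dist (f (node_below n (m n) t)) (f t) \<le> 1 / (real n + 1)))"

text \<open>
  A continuous function is uniformly continuous on \<open>[-n, n]\<close>, so a small enough step works for
  each \<open>n\<close>.
\<close>

lemma fine_mesh_exists:
  fixes f :: "real \<Rightarrow> 'b::metric_space"
  assumes "continuous_on UNIV f"
  shows "\<exists>m. fine_mesh f m"
proof -
  have "\<exists>m>0. \<forall>t\<in>{- real n..<real n}. dist (f (node_below n m t)) (f t) \<le> 1 / (real n + 1)" for n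
  proof -
    have "uniformly_continuous_on {- real n..real n} f"
      using assms by (intro compact_uniformly_continuous) (auto intro: continuous_on_subset)
    then obtain d where d: "d > 0" "\<And>s t. s \<in> {- real n..real n} \<Longrightarrow> t \<in> {- real n..real n} \<Longrightarrow>
        dist s t < d \<Longrightarrow> dist (f s) (f t) < 1 / (real n + 1)"
      unfolding uniformly_continuous_on_def
      by (metis (no_types, opaque_lifting) divide_pos_pos of_nat_0_le_iff zero_less_one
          add_nonneg_pos)
    obtain m where m: "0 < m" "1 / real m < d"
      using d(1) by (metis nat_approx_posE zero_less_Suc)
    have "dist (f (node_below n m t)) (f t) \<le> 1 / (real n + 1)" if "t \<in> {- real n..<real n}" for t
    proof (intro less_imp_le d(2))
      show "node_below n m t \<in> {- real n..real n}" "t \<in> {- real n..real n}"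
        "dist (node_below n m t) t < d"
        using node_below_close[OF m(1), of n t] that m(2) by (auto simp: dist_real_def)
    qed
    with m(1) show ?thesis
      by blast
  qed
  then show ?thesis
    unfolding fine_mesh_def by metis
qed

lemma fine_mesh_fst: "fine_mesh (\<lambda>t. (f t, g t)) m \<Longrightarrow> fine_mesh f m"
  unfolding fine_mesh_def by (metis (no_types, lifting) dist_fst_le fst_conv order_trans)

lemma fine_mesh_snd: "fine_mesh (\<lambda>t. (f t, g t)) m \<Longrightarrow> fine_mesh g m"
  unfolding fine_mesh_def by (metis (no_types, lifting) dist_snd_le snd_conv order_trans)

lemma sample_error:
  assumes "fine_mesh f m"
  shows "t \<in> {- real n..<real n} \<Longrightarrow> cmod (f t - step_fun (sample f n (m n)) t) \<le> 1 / (real n + 1)"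
    and "t \<notin> {- real n..<real n} \<Longrightarrow> step_fun (sample f n (m n)) t = 0"
  using assms by (auto simp: fine_mesh_def step_fun_sample dist_norm norm_minus_commute)

lemma sample_tendsto:
  assumes "fine_mesh f m"
  shows "(\<lambda>n. step_fun (sample f n (m n)) t) \<longlonglongrightarrow> f t"
proof -
  have "(\<lambda>n. step_fun (sample f n (m n)) t - f t) \<longlonglongrightarrow> 0"
  proof (rule Lim_null_comparison)
    show "(\<lambda>n. 1 / (real n + 1)) \<longlonglongrightarrow> 0"
      using LIMSEQ_inverse_real_of_nat by (simp add: inverse_eq_divide add.commute)
    obtain N where N: "\<bar>t\<bar> < real N"
      using reals_Archimedean2 by blast
    show "\<forall>\<^sub>F n in sequentially. cmod (step_fun (sample f n (m n)) t - f t) \<le> 1 / (real n + 1)"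
      using eventually_ge_at_top[of N]
    proof eventually_elim
      case (elim n)
      then have "real N \<le> real n"
        by simp
      with N have "t \<in> {- real n..<real n}"
        by auto
      from sample_error(1)[OF assms this] show ?case
        by (simp add: norm_minus_commute)
    qed
  qed
  then show ?thesis
    by (rule LIM_zero_cancel)
qed

text \<open>
  Bounds uniform in \<open>n\<close>, as needed for dominated convergence: they are integrable because the
  spectral measures are finite.
\<close>

lemma sample_le:
  assumes "fine_mesh f m"
  shows "(cmod (step_fun (sample f n (m n)) t))\<^sup>2 \<le> 2 * (cmod (f t))\<^sup>2 + 2"
    and "(cmod (f t - step_fun (sample f n (m n)) t))\<^sup>2 \<le> (cmod (f t))\<^sup>2 + 1"
proof -
  let ?s = "step_fun (sample f n (m n)) t"
  have err: "(cmod (f t - ?s))\<^sup>2 \<le> 1 \<and> cmod ?s \<le> cmod (f t) + 1" if "t \<in> {- real n..<real n}"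
  proof -
    have "cmod (f t - ?s) \<le> 1 / (real n + 1)"
      using sample_error(1)[OF assms that] .
    also have "\<dots> \<le> 1"
      by simp
    finally have "cmod (f t - ?s) \<le> 1" .
    then show ?thesis
      using norm_triangle_sub[of ?s "f t"] by (simp add: norm_minus_commute abs_square_le_1)
  qed
  show "(cmod (f t - ?s))\<^sup>2 \<le> (cmod (f t))\<^sup>2 + 1"
    using err sample_error(2)[OF assms] by (cases "t \<in> {- real n..<real n}") (auto simp: add_increasing)
  have "(cmod ?s)\<^sup>2 \<le> (cmod (f t) + 1)\<^sup>2"
    using err sample_error(2)[OF assms] by (cases "t \<in> {- real n..<real n}") (auto intro: power_mono)
  also have "\<dots> \<le> 2 * (cmod (f t))\<^sup>2 + 2"
    using sum_squares_bound[of "cmod (f t)" 1] by (simp add: power2_sum)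
  finally show "(cmod ?s)\<^sup>2 \<le> 2 * (cmod (f t))\<^sup>2 + 2" .
qed


section \<open>The spectral measure\<close>

lemma sets_spectral_measure [simp, measurable_cong]: "sets (spectral_measure E x) = sets borel"
  by (simp add: spectral_measure_def)

lemma space_spectral_measure [simp]: "space (spectral_measure E x) = UNIV"
  by (simp add: spectral_measure_def)

context
  fixes E :: "real \<Rightarrow> 'a::complex_inner \<Rightarrow> 'a"
  assumes sf: "spectral_family E"
begin

lemma projection: "orthogonal_projection (E t)"
  using sf by (simp add: spectral_family_def)

lemma E_E: "E s (E t x) = E (min s t) x"
  using sf by (simp add: spectral_family_def)

lemmas E_add = projection_add[OF projection]
  and E_scaleC = projection_scaleC[OF projection]
  and E_diff = projection_diff[OF projection]

lemma cinner_E_E: "cinner (E s x) (E t y) = cinner (E (min s t) x) y"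
proof -
  have "cinner (E s x) (E t y) = cinner (E t (E s x)) y"
    using projection[of t] by (simp add: orthogonal_projection_def)
  then show ?thesis
    by (simp add: E_E min.commute)
qed

text \<open>
  Hence the distribution function \<open>(E\<^sub>t x, x)\<close> is \<open>\<parallel>E\<^sub>t x\<parallel>\<^sup>2\<close>.
\<close>

lemma cinner_E_self: "cinner (E t x) x = complex_of_real ((norm (E t x))\<^sup>2)"
  using cinner_E_E[of t x t x] by (simp add: cinner_self)

lemma increment_idem:
  assumes "a \<le> b"
  shows "E b (E b x - E a x) - E a (E b x - E a x) = E b x - E a x"
  using assms by (simp add: E_diff E_E min_def)

lemma norm_increment:
  assumes "a \<le> b"
  shows "(norm (E b x - E a x))\<^sup>2 = (norm (E b x))\<^sup>2 - (norm (E a x))\<^sup>2"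
proof -
  have "cinner (E b x - E a x) (E b x - E a x)
      = complex_of_real ((norm (E b x))\<^sup>2 - (norm (E a x))\<^sup>2)"
    using assms by (simp add: cinner_diff_left cinner_diff_right cinner_E_E cinner_E_self)
  then show ?thesis
    by (simp only: cinner_self of_real_eq_iff)
qed

lemma norm_E_mono:
  assumes "a \<le> b"
  shows "norm (E a x) \<le> norm (E b x)"
proof (rule power2_le_imp_le)
  show "(norm (E a x))\<^sup>2 \<le> (norm (E b x))\<^sup>2"
    using norm_increment[OF assms, of x] zero_le_power2[of "norm (E b x - E a x)"] by linarith
qed simp

lemma norm_E_at_top: "((\<lambda>t. (norm (E t x))\<^sup>2) \<longlongrightarrow> (norm x)\<^sup>2) at_top"
  using sf by (intro tendsto_intros) (simp add: spectral_family_def)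

lemma norm_E_at_bot: "((\<lambda>t. (norm (E t x))\<^sup>2) \<longlongrightarrow> 0) at_bot"
proof -
  have "((\<lambda>t. (norm (E t x))\<^sup>2) \<longlongrightarrow> (norm (0::'a))\<^sup>2) at_bot"
    using sf by (intro tendsto_intros) (simp add: spectral_family_def)
  then show ?thesis
    by simp
qed

lemma norm_E_at_left: "((\<lambda>t. (norm (E t x))\<^sup>2) \<longlongrightarrow> (norm (E a x))\<^sup>2) (at_left a)"
  using sf by (intro tendsto_intros) (simp add: spectral_family_def)

lemma norm_E_le: "norm (E t x) \<le> norm x"
proof (rule power2_le_imp_le)
  show "(norm (E t x))\<^sup>2 \<le> (norm x)\<^sup>2"
    by (rule tendsto_lowerbound[OF norm_E_at_top[of x]])
      (auto intro!: eventually_mono[OF eventually_ge_at_top[of t]] norm_E_mono)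
qed simp

text \<open>
  The right-continuous version of \<open>t \<mapsto> \<parallel>E\<^sub>t x\<parallel>\<^sup>2\<close>, that is the mass of \<open>{..t}\<close>, whereas
  \<open>\<parallel>E\<^sub>t x\<parallel>\<^sup>2\<close> itself is the mass of \<open>{..<t}\<close>.
\<close>

definition upper_mass :: "'a \<Rightarrow> real \<Rightarrow> real" where
  "upper_mass x t = Lim (at_right t) (\<lambda>s. (norm (E s x))\<^sup>2)"

lemma spectral_measure_upper_mass: "spectral_measure E x = interval_measure (upper_mass x)"
proof -
  have "(\<lambda>t. Lim (at_right t) (\<lambda>s. Re (cinner (E s x) x))) = upper_mass x"
    by (rule ext) (simp only: upper_mass_def cinner_E_self Re_complex_of_real)
  then show ?thesis
    by (simp only: spectral_measure_def)
qed

lemma upper_mass_tendsto: "((\<lambda>s. (norm (E s x))\<^sup>2) \<longlongrightarrow> upper_mass x t) (at_right t)"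
proof -
  let ?g = "\<lambda>s. (norm (E s x))\<^sup>2"
  have "(?g \<longlongrightarrow> Inf (?g ` {t<..})) (at_right t)"
  proof (intro order_tendstoI)
    fix l assume l: "l < Inf (?g ` {t<..})"
    have "bdd_below (?g ` {t<..})"
      by (rule bdd_belowI[of _ 0]) auto
    then have "l < ?g s" if "t < s" for s
      using that cInf_lower[of "?g s" "?g ` {t<..}"] l by auto
    then show "\<forall>\<^sub>F s in at_right t. l < ?g s"
      by (intro eventually_mono[OF eventually_at_right_less])
  next
    fix u assume "Inf (?g ` {t<..}) < u"
    then obtain s where s: "t < s" "?g s < u"
      using cInf_lessD[of "?g ` {t<..}" u] by auto
    show "\<forall>\<^sub>F s in at_right t. ?g s < u"
      using eventually_at_right_real[OF s(1)]
    proof eventually_elim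
      case (elim r)
      then show ?case
        by (intro le_less_trans[OF power_mono s(2)] norm_E_mono) auto
    qed
  qed
  then show ?thesis
    unfolding upper_mass_def by (simp add: tendsto_Lim)
qed

lemma upper_mass_ge: "(norm (E t x))\<^sup>2 \<le> upper_mass x t"
  by (rule tendsto_lowerbound[OF upper_mass_tendsto[of x t]])
    (auto intro!: eventually_mono[OF eventually_at_right_less[of t]] norm_E_mono)

lemma upper_mass_le:
  assumes "t < s"
  shows "upper_mass x t \<le> (norm (E s x))\<^sup>2"
  by (rule tendsto_upperbound[OF upper_mass_tendsto[of x t]])
    (auto intro!: eventually_mono[OF eventually_at_right_real[OF assms]] norm_E_mono)

lemma upper_mass_mono: "s \<le> t \<Longrightarrow> upper_mass x s \<le> upper_mass x t"
  using upper_mass_le[of s t x] upper_mass_ge[of t x] by (cases "s = t") auto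

lemma upper_mass_right_continuous: "continuous (at_right t) (upper_mass x)"
  unfolding continuous_within
proof (rule order_tendstoI)
  fix l assume "l < upper_mass x t"
  then have "l < upper_mass x s" if "t < s" for s
    using upper_mass_mono[of t s x] that by auto
  then show "\<forall>\<^sub>F s in at_right t. l < upper_mass x s"
    by (intro eventually_mono[OF eventually_at_right_less])
next
  fix u assume "upper_mass x t < u"
  then have "\<forall>\<^sub>F s in at_right t. (norm (E s x))\<^sup>2 < u"
    by (rule order_tendstoD(2)[OF upper_mass_tendsto])
  then obtain b where b: "t < b" "\<And>s. t < s \<Longrightarrow> s < b \<Longrightarrow> (norm (E s x))\<^sup>2 < u"
    by (auto simp: eventually_at_right_field)
  show "\<forall>\<^sub>F s in at_right t. upper_mass x s < u"
    using eventually_at_right_real[OF b(1)]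
  proof eventually_elim
    case (elim r)
    obtain r' where "r < r'" "r' < b"
      using dense[of r b] elim by auto
    then show ?case
      using upper_mass_le[of r r' x] b(2)[of r'] elim by auto
  qed
qed

lemma emeasure_Ioc:
  "a \<le> b \<Longrightarrow> emeasure (spectral_measure E x) {a<..b} = ennreal (upper_mass x b - upper_mass x a)"
  unfolding spectral_measure_upper_mass
  by (intro emeasure_interval_measure_Ioc upper_mass_mono upper_mass_right_continuous)

lemma upper_mass_at_top: "(upper_mass x \<longlongrightarrow> (norm x)\<^sup>2) at_top"
proof (rule tendsto_sandwich[OF _ _ norm_E_at_top tendsto_const])
  show "\<forall>\<^sub>F t in at_top. (norm (E t x))\<^sup>2 \<le> upper_mass x t"
    by (simp add: upper_mass_ge)
  show "\<forall>\<^sub>F t in at_top. upper_mass x t \<le> (norm x)\<^sup>2"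
  proof (rule always_eventually, rule allI)
    fix t
    show "upper_mass x t \<le> (norm x)\<^sup>2"
      using upper_mass_le[of t "t + 1" x] power_mono[OF norm_E_le[of "t + 1" x] norm_ge_zero, of 2]
      by linarith
  qed
qed

lemma upper_mass_at_bot: "(upper_mass x \<longlongrightarrow> 0) at_bot"
proof (rule order_tendstoI)
  fix l :: real assume "l < 0"
  then have "l < upper_mass x t" for t
    using upper_mass_ge[of t x] zero_le_power2[of "norm (E t x)"] by linarith
  then show "\<forall>\<^sub>F t in at_bot. l < upper_mass x t"
    by simp
next
  fix u :: real assume "0 < u"
  then have "\<forall>\<^sub>F t in at_bot. (norm (E t x))\<^sup>2 < u"
    by (rule order_tendstoD(2)[OF norm_E_at_bot])
  then obtain N where "(norm (E N x))\<^sup>2 < u"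
    by (auto simp: eventually_at_bot_linorder)
  then show "\<forall>\<^sub>F t in at_bot. upper_mass x t < u"
    by (intro eventually_mono[OF eventually_gt_at_bot[of N]])
      (rule order_le_less_trans[OF upper_mass_le])
qed

lemma emeasure_UNIV: "emeasure (spectral_measure E x) UNIV = ennreal ((norm x)\<^sup>2)"
proof -
  have 1: "(\<lambda>n. emeasure (spectral_measure E x) {- real n<..real n}) \<longlonglongrightarrow> emeasure (spectral_measure E x) (\<Union>n. {- real n<..real n})"
    by (intro Lim_emeasure_incseq) (auto simp: incseq_def)
  have 2: "(\<Union>n. {- real n<..real n}) = UNIV"
  proof safe
    fix t :: real
    obtain n where "\<bar>t\<bar> < real n"
      using reals_Archimedean2 by blast
    then show "t \<in> (\<Union>n. {- real n<..real n})"
      by (intro UN_I[of n]) auto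
  qed auto
  have "(\<lambda>n. ennreal (upper_mass x (real n) - upper_mass x (- real n))) \<longlonglongrightarrow> ennreal ((norm x)\<^sup>2 - 0)"
    by (intro tendsto_intros filterlim_compose[OF upper_mass_at_top]
        filterlim_compose[OF upper_mass_at_bot] filterlim_real_sequentially
        filterlim_compose[OF filterlim_uminus_at_bot_at_top])
  then have 3: "(\<lambda>n. emeasure (spectral_measure E x) {- real n<..real n}) \<longlonglongrightarrow> ennreal ((norm x)\<^sup>2)"
    by (simp add: emeasure_Ioc)
  show ?thesis
    using LIMSEQ_unique[OF 1 3] unfolding 2 .
qed

lemma finite_spectral_measure: "finite_measure (spectral_measure E x)"
  by (rule finite_measureI) (simp add: emeasure_UNIV)

text \<open>
  Since the interval measure is given on \<open>{a<..b}\<close>, the interval is shifted to the left by a null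
  sequence; left continuity of \<open>E\<close> then identifies the limit of the masses.
\<close>

lemma spectral_measure_Ico:
  assumes "a \<le> b"
  shows "measure (spectral_measure E x) {a..<b} = (norm (E b x))\<^sup>2 - (norm (E a x))\<^sup>2"
proof -
  interpret finite_measure "spectral_measure E x"
    by (rule finite_spectral_measure)
  define h where "h n = inverse (real (Suc n))" for n :: nat
  have h: "h \<longlonglongrightarrow> 0"
    unfolding h_def by (rule LIMSEQ_inverse_real_of_nat)
  have h_pos: "h n > 0" for n
    by (simp add: h_def)
  \<comment> \<open>the sets \<open>{a - h n<..b - h n}\<close> converge pointwise to \<open>{a..<b}\<close>\<close>
  have "(\<lambda>n. \<integral>t. indicat_real {a - h n<..b - h n} t \<partial>spectral_measure E x) \<longlonglongrightarrow> (\<integral>t. indicat_real {a..<b} t \<partial>spectral_measure E x)"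
  proof (rule integral_dominated_convergence[where w = "\<lambda>_. 1"])
    show "AE t in spectral_measure E x. (\<lambda>n. indicat_real {a - h n<..b - h n} t) \<longlonglongrightarrow> indicat_real {a..<b} t"
    proof (rule AE_I2)
      fix t
      have "\<forall>\<^sub>F n in sequentially. indicat_real {a - h n<..b - h n} t = indicat_real {a..<b} t"
      proof -
        consider "t < a" | "a \<le> t" "t < b" | "b \<le> t"
          by linarith
        then show ?thesis
        proof cases
          case 1
          then have "\<forall>\<^sub>F n in sequentially. h n < a - t"
            by (intro order_tendstoD(2)[OF h]) simp
          then show ?thesis
            by eventually_elim (use 1 in \<open>auto simp: indicator_def\<close>)
        next
          case 2
          then have "\<forall>\<^sub>F n in sequentially. h n < b - t"
            by (intro order_tendstoD(2)[OF h]) simp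
          then show ?thesis
          proof eventually_elim
            case (elim n)
            then show ?case
              using 2 h_pos[of n] by (auto simp: indicator_def)
          qed
        next
          case 3
          show ?thesis
          proof (rule always_eventually, rule allI)
            fix n
            show "indicat_real {a - h n<..b - h n} t = indicat_real {a..<b} t"
              using 3 h_pos[of n] by (auto simp: indicator_def)
          qed
        qed
      qed
      then show "(\<lambda>n. indicat_real {a - h n<..b - h n} t) \<longlonglongrightarrow> indicat_real {a..<b} t"
        by (rule tendsto_eventually)
    qed
  qed (auto simp: indicator_def)
  then have 1: "(\<lambda>n. measure (spectral_measure E x) {a - h n<..b - h n}) \<longlonglongrightarrow> measure (spectral_measure E x) {a..<b}"
    by simp
  have 2: "(\<lambda>n. upper_mass x (c - h n)) \<longlonglongrightarrow> (norm (E c x))\<^sup>2" for c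
  proof (rule tendsto_sandwich[OF _ _ _ tendsto_const])
    have "(\<lambda>n. c - h n) \<longlonglongrightarrow> c - 0"
      by (intro tendsto_intros h)
    then have "filterlim (\<lambda>n. c - h n) (at_left c) sequentially"
      using h_pos by (auto simp: filterlim_at less_imp_neq[symmetric] intro!: always_eventually)
    then show "(\<lambda>n. (norm (E (c - h n) x))\<^sup>2) \<longlonglongrightarrow> (norm (E c x))\<^sup>2"
      by (rule filterlim_compose[OF norm_E_at_left])
  qed (use h_pos in \<open>auto intro!: always_eventually upper_mass_ge upper_mass_le\<close>)
  have "measure (spectral_measure E x) {a - h n<..b - h n} = upper_mass x (b - h n) - upper_mass x (a - h n)" for n
    using assms by (simp add: measure_def emeasure_Ioc upper_mass_mono)
  with tendsto_diff[OF 2[of b] 2[of a]]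
  have "(\<lambda>n. measure (spectral_measure E x) {a - h n<..b - h n}) \<longlonglongrightarrow> (norm (E b x))\<^sup>2 - (norm (E a x))\<^sup>2"
    by simp
  with 1 show ?thesis
    by (rule LIMSEQ_unique)
qed

text \<open>
  The polarised form of the previous lemma: the operators \<open>E\<^sub>b - E\<^sub>a\<close> multiply like the indicator
  functions of the intervals \<open>{a..<b}\<close>.
\<close>

lemma cinner_increments:
  assumes "a \<le> b" and "c \<le> d"
  shows "cinner (E b x - E a x) (E d x - E c x)
    = complex_of_real (measure (spectral_measure E x) ({a..<b} \<inter> {c..<d}))"
proof -
  let ?g = "\<lambda>t. (norm (E t x))\<^sup>2"
  have *: "{a..<b} \<inter> {c..<d} = {max a c..<min b d}"
    by auto
  have "cinner (E b x - E a x) (E d x - E c x)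
      = complex_of_real (?g (min b d) - ?g (min a d) - ?g (min b c) + ?g (min a c))"
    by (simp add: cinner_diff_left cinner_diff_right cinner_E_E cinner_E_self)
  also have "?g (min b d) - ?g (min a d) - ?g (min b c) + ?g (min a c)
      = measure (spectral_measure E x) {max a c..<min b d}"
  proof (cases "max a c \<le> min b d")
    case True
    then show ?thesis
      using assms by (subst spectral_measure_Ico) (auto simp: min_def max_def)
  next
    case False
    then show ?thesis
      using assms by (auto simp: min_def max_def split: if_splits)
  qed
  finally show ?thesis
    by (simp only: *)
qed


section \<open>The isometry of step functions\<close>

lemma integrable_step_fun_product:
  "integrable (spectral_measure E x) (\<lambda>t. step_fun L t * cnj (step_fun K t))"
proof -
  interpret finite_measure "spectral_measure E x"
    by (rule finite_spectral_measure)
  obtain B C where BC: "\<And>t. cmod (step_fun L t) \<le> B" "\<And>t. cmod (step_fun K t) \<le> C"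
    using step_fun_bounded[of L] step_fun_bounded[of K] by blast
  show ?thesis
  proof (rule integrable_const_bound)
    show "AE t in spectral_measure E x. cmod (step_fun L t * cnj (step_fun K t)) \<le> B * C"
      using order_trans[OF norm_ge_zero BC(1)]
      by (auto simp: norm_mult intro!: mult_mono BC)
    have [measurable]: "cnj \<in> borel_measurable borel"
      by (intro borel_measurable_continuous_onI continuous_intros)
    show "(\<lambda>t. step_fun L t * cnj (step_fun K t)) \<in> borel_measurable (spectral_measure E x)"
      by measurable
  qed
qed

lemma step_integral_Nil [simp]: "step_integral E [] x = 0"
  by (simp add: step_integral_def)

lemma step_integral_Cons:
  "step_integral E ((c, a, b) # L) x = c *\<^sub>C (E b x - E a x) + step_integral E L x"
  by (simp add: step_integral_def)

text \<open>
  Both sides are sesquilinear in the two lists, which reduces the claim to single intervals.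
  Proving it for two different lists spares any discussion of how the intervals within one list
  overlap.
\<close>

lemma cinner_step_integral:
  assumes "valid_step L" and "valid_step K"
  shows "cinner (step_integral E L x) (step_integral E K x)
    = (\<integral>t. step_fun L t * cnj (step_fun K t) \<partial>spectral_measure E x)"
  using assms(1)
proof (induction L)
  case (Cons p L)
  obtain c a b where p: "p = (c, a, b)"
    by (cases p)
  have ab: "a \<le> b" and L: "valid_step L"
    using Cons.prems by (simp_all add: p valid_step_Cons)
  have single: "cinner (c *\<^sub>C (E b x - E a x)) (step_integral E K x)
      = (\<integral>t. step_fun [(c, a, b)] t * cnj (step_fun K t) \<partial>spectral_measure E x)"
    using assms(2)
  proof (induction K)
    case (Cons q K)
    obtain d u v where q: "q = (d, u, v)"
      by (cases q)
    have uv: "u \<le> v" and K: "valid_step K"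
      using Cons.prems by (simp_all add: q valid_step_Cons)
    have "(\<integral>t. step_fun [(c, a, b)] t * cnj (step_fun (q # K) t) \<partial>spectral_measure E x)
        = (\<integral>t. step_fun [(c, a, b)] t * cnj (step_fun [q] t)
            + step_fun [(c, a, b)] t * cnj (step_fun K t) \<partial>spectral_measure E x)"
      by (simp add: q step_fun_Cons ring_distribs)
    also have "\<dots> = (\<integral>t. step_fun [(c, a, b)] t * cnj (step_fun [q] t) \<partial>spectral_measure E x)
        + (\<integral>t. step_fun [(c, a, b)] t * cnj (step_fun K t) \<partial>spectral_measure E x)"
      by (intro Bochner_Integration.integral_add integrable_step_fun_product)
    also have "(\<integral>t. step_fun [(c, a, b)] t * cnj (step_fun [q] t) \<partial>spectral_measure E x)
        = (\<integral>t. (c * cnj d) * complex_of_real (indicator ({a..<b} \<inter> {u..<v}) t) \<partial>spectral_measure E x)"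
      by (intro Bochner_Integration.integral_cong)
        (auto simp: q step_fun_single indicator_def)
    also have "\<dots> = (c * cnj d) * complex_of_real (measure (spectral_measure E x) ({a..<b} \<inter> {u..<v}))"
      by (simp add: integral_complex_of_real)
    also have "\<dots> = cinner (c *\<^sub>C (E b x - E a x)) (d *\<^sub>C (E v x - E u x))"
      using cinner_increments[OF ab uv, of x]
      by (simp add: cinner_scaleC_left cinner_scaleC_right)
    finally show ?case
      using Cons.IH[OF K] by (simp add: q step_integral_Cons cinner_add_right)
  qed simp
  have "(\<integral>t. step_fun (p # L) t * cnj (step_fun K t) \<partial>spectral_measure E x)
      = (\<integral>t. step_fun [(c, a, b)] t * cnj (step_fun K t)
          + step_fun L t * cnj (step_fun K t) \<partial>spectral_measure E x)"
    by (simp add: p step_fun_Cons ring_distribs)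
  also have "\<dots> = (\<integral>t. step_fun [(c, a, b)] t * cnj (step_fun K t) \<partial>spectral_measure E x)
      + (\<integral>t. step_fun L t * cnj (step_fun K t) \<partial>spectral_measure E x)"
    by (intro Bochner_Integration.integral_add integrable_step_fun_product)
  finally show ?case
    using Cons.IH[OF L] single by (simp add: p step_integral_Cons cinner_add_left)
qed simp

lemma norm_step_integral:
  assumes "valid_step L"
  shows "ennreal ((norm (step_integral E L x))\<^sup>2)
    = (\<integral>\<^sup>+ t. ennreal ((cmod (step_fun L t))\<^sup>2) \<partial>spectral_measure E x)"
proof -
  have *: "step_fun L t * cnj (step_fun L t) = complex_of_real ((cmod (step_fun L t))\<^sup>2)" for t
    by (simp only: complex_norm_square)
  have int: "integrable (spectral_measure E x) (\<lambda>t. (cmod (step_fun L t))\<^sup>2)"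
    using integrable_Re[OF integrable_step_fun_product[of x L L]]
    unfolding * Re_complex_of_real .
  have "complex_of_real ((norm (step_integral E L x))\<^sup>2)
      = (\<integral>t. complex_of_real ((cmod (step_fun L t))\<^sup>2) \<partial>spectral_measure E x)"
    using cinner_step_integral[OF assms assms, of x] unfolding * cinner_self .
  also have "\<dots> = complex_of_real (\<integral>t. (cmod (step_fun L t))\<^sup>2 \<partial>spectral_measure E x)"
    by (rule integral_of_real[OF int])
  finally have "(norm (step_integral E L x))\<^sup>2 = (\<integral>t. (cmod (step_fun L t))\<^sup>2 \<partial>spectral_measure E x)"
    by (simp only: of_real_eq_iff)
  then show ?thesis
    using nn_integral_eq_integral[OF int] by simp
qed

lemma step_integral_diff:
  "step_integral E (step_diff L K) x = step_integral E L x - step_integral E K x"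
proof -
  have "step_integral E (map (\<lambda>(c, a, b). (- c, a, b)) K) x = - step_integral E K x"
    by (induction K) (auto simp: step_integral_Cons complex_vector.scale_minus_left)
  then show ?thesis
    by (simp add: step_diff_def step_integral_def)
qed

text \<open>
  Step functions that approximate one function in the mean square are close to each other,
  hence so are their integrals.
\<close>

lemma step_integral_dist:
  assumes f: "f \<in> borel_measurable borel" and L: "valid_step L" and K: "valid_step K"
  shows "ennreal ((norm (step_integral E L x - step_integral E K x))\<^sup>2)
    \<le> 2 * (\<integral>\<^sup>+ t. ennreal ((cmod (f t - step_fun L t))\<^sup>2) \<partial>spectral_measure E x)
      + 2 * (\<integral>\<^sup>+ t. ennreal ((cmod (f t - step_fun K t))\<^sup>2) \<partial>spectral_measure E x)"
proof -
  note [measurable] = f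
  have ptw: "(cmod (step_fun L t - step_fun K t))\<^sup>2
      \<le> 2 * (cmod (f t - step_fun L t))\<^sup>2 + 2 * (cmod (f t - step_fun K t))\<^sup>2" for t
  proof -
    let ?u = "cmod (f t - step_fun L t)" and ?v = "cmod (f t - step_fun K t)"
    have "cmod (step_fun L t - step_fun K t) \<le> ?u + ?v"
      using norm_triangle_ineq4[of "f t - step_fun K t" "f t - step_fun L t"] by simp
    then have "(cmod (step_fun L t - step_fun K t))\<^sup>2 \<le> (?u + ?v)\<^sup>2"
      by (simp add: power_mono)
    also have "\<dots> \<le> 2 * ?u\<^sup>2 + 2 * ?v\<^sup>2"
      using sum_squares_bound[of ?u ?v] by (simp add: power2_sum)
    finally show ?thesis .
  qed
  have "ennreal ((norm (step_integral E L x - step_integral E K x))\<^sup>2)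
      = (\<integral>\<^sup>+ t. ennreal ((cmod (step_fun L t - step_fun K t))\<^sup>2) \<partial>spectral_measure E x)"
    using norm_step_integral[OF valid_step_diff[OF L K], of x]
    by (simp add: step_integral_diff step_fun_diff)
  also have "\<dots> \<le> (\<integral>\<^sup>+ t. 2 * ennreal ((cmod (f t - step_fun L t))\<^sup>2)
      + 2 * ennreal ((cmod (f t - step_fun K t))\<^sup>2) \<partial>spectral_measure E x)"
  proof (intro nn_integral_mono)
    fix t
    show "ennreal ((cmod (step_fun L t - step_fun K t))\<^sup>2)
        \<le> 2 * ennreal ((cmod (f t - step_fun L t))\<^sup>2) + 2 * ennreal ((cmod (f t - step_fun K t))\<^sup>2)"
      using ennreal_leI[OF ptw[of t]] by (simp add: ennreal_plus ennreal_mult)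
  qed
  also have "\<dots> = 2 * (\<integral>\<^sup>+ t. ennreal ((cmod (f t - step_fun L t))\<^sup>2) \<partial>spectral_measure E x)
      + 2 * (\<integral>\<^sup>+ t. ennreal ((cmod (f t - step_fun K t))\<^sup>2) \<partial>spectral_measure E x)"
    by (simp add: nn_integral_add nn_integral_cmult)
  finally show ?thesis .
qed

lemma has_spectral_integral_unique:
  assumes f: "f \<in> borel_measurable borel"
    and u: "has_spectral_integral E f x u" and v: "has_spectral_integral E f x v"
  shows "u = v"
proof -
  let ?e = "\<lambda>L. \<integral>\<^sup>+ t. ennreal ((cmod (f t - step_fun L t))\<^sup>2) \<partial>spectral_measure E x"
  obtain L where L: "\<And>n. valid_step (L n)" "(\<lambda>n. ?e (L n)) \<longlonglongrightarrow> 0"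
      "(\<lambda>n. step_integral E (L n) x) \<longlonglongrightarrow> u"
    using u unfolding has_spectral_integral_def by blast
  obtain K where K: "\<And>n. valid_step (K n)" "(\<lambda>n. ?e (K n)) \<longlonglongrightarrow> 0"
      "(\<lambda>n. step_integral E (K n) x) \<longlonglongrightarrow> v"
    using v unfolding has_spectral_integral_def by blast
  have lim: "(\<lambda>n. 2 * ?e (L n) + 2 * ?e (K n)) \<longlonglongrightarrow> 2 * 0 + 2 * 0"
    by (intro tendsto_add ennreal_tendsto_cmult L K) auto
  have "(\<lambda>n. ennreal ((norm (step_integral E (L n) x - step_integral E (K n) x))\<^sup>2))
      \<longlonglongrightarrow> ennreal ((norm (u - v))\<^sup>2)"
    by (intro tendsto_intros L K)
  from this lim have "ennreal ((norm (u - v))\<^sup>2) \<le> 2 * 0 + 2 * 0"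
    by (rule LIMSEQ_le) (use step_integral_dist[OF f L(1) K(1)] in blast)
  then show ?thesis
    by (simp add: ennreal_eq_0_iff)
qed

lemma spectral_op_eqI:
  assumes "f \<in> borel_measurable borel" and "has_spectral_integral E f x v"
  shows "spectral_op E f x = v"
  unfolding spectral_op_def using assms has_spectral_integral_unique by blast

lemma sample_L2:
  assumes f: "continuous_on UNIV f" and m: "fine_mesh f m" and x: "x \<in> spectral_dom E f"
  shows "(\<lambda>n. \<integral>\<^sup>+ t. ennreal ((cmod (f t - step_fun (sample f n (m n)) t))\<^sup>2) \<partial>spectral_measure E x) \<longlonglongrightarrow> 0"
    and "(\<lambda>n. \<integral>\<^sup>+ t. ennreal ((cmod (step_fun (sample f n (m n)) t))\<^sup>2) \<partial>spectral_measure E x)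
      \<longlonglongrightarrow> (\<integral>\<^sup>+ t. ennreal ((cmod (f t))\<^sup>2) \<partial>spectral_measure E x)"
proof -
  have [measurable]: "f \<in> borel_measurable borel"
    using f by (rule borel_measurable_continuous_onI)
  have dom: "(\<integral>\<^sup>+ t. ennreal (a * (cmod (f t))\<^sup>2 + b) \<partial>spectral_measure E x) < \<infinity>" if "0 \<le> a" "0 \<le> b" for a b
  proof -
    have "(\<integral>\<^sup>+ t. ennreal (a * (cmod (f t))\<^sup>2 + b) \<partial>spectral_measure E x)
        = (\<integral>\<^sup>+ t. ennreal a * ennreal ((cmod (f t))\<^sup>2) + ennreal b \<partial>spectral_measure E x)"
      using that by (intro nn_integral_cong) (simp add: ennreal_plus ennreal_mult)
    also have "\<dots> = ennreal a * (\<integral>\<^sup>+ t. ennreal ((cmod (f t))\<^sup>2) \<partial>spectral_measure E x) + ennreal b * emeasure (spectral_measure E x) UNIV"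
      by (subst nn_integral_add) (simp_all add: nn_integral_cmult)
    also have "\<dots> < \<infinity>"
      using x by (simp add: spectral_dom_def emeasure_UNIV ennreal_mult_less_top)
    finally show ?thesis .
  qed
  have "(\<lambda>n. \<integral>\<^sup>+ t. ennreal ((cmod (f t - step_fun (sample f n (m n)) t))\<^sup>2) \<partial>spectral_measure E x)
      \<longlonglongrightarrow> (\<integral>\<^sup>+ t. ennreal ((cmod (f t - f t))\<^sup>2) \<partial>spectral_measure E x)"
  proof (rule nn_integral_dominated_convergence[OF _ _ _ _ dom[of 1 1]])
    show "AE t in spectral_measure E x. ennreal ((cmod (f t - step_fun (sample f n (m n)) t))\<^sup>2)
        \<le> ennreal (1 * (cmod (f t))\<^sup>2 + 1)" for n
      using sample_le(2)[OF m] by (intro AE_I2 ennreal_leI) simp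
    show "AE t in spectral_measure E x. (\<lambda>n. ennreal ((cmod (f t - step_fun (sample f n (m n)) t))\<^sup>2))
        \<longlonglongrightarrow> ennreal ((cmod (f t - f t))\<^sup>2)"
      by (intro AE_I2 tendsto_intros sample_tendsto[OF m])
  qed simp_all
  then show "(\<lambda>n. \<integral>\<^sup>+ t. ennreal ((cmod (f t - step_fun (sample f n (m n)) t))\<^sup>2) \<partial>spectral_measure E x) \<longlonglongrightarrow> 0"
    by simp
  show "(\<lambda>n. \<integral>\<^sup>+ t. ennreal ((cmod (step_fun (sample f n (m n)) t))\<^sup>2) \<partial>spectral_measure E x)
      \<longlonglongrightarrow> (\<integral>\<^sup>+ t. ennreal ((cmod (f t))\<^sup>2) \<partial>spectral_measure E x)"
  proof (rule nn_integral_dominated_convergence[OF _ _ _ _ dom[of 2 2]])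
    show "AE t in spectral_measure E x. ennreal ((cmod (step_fun (sample f n (m n)) t))\<^sup>2)
        \<le> ennreal (2 * (cmod (f t))\<^sup>2 + 2)" for n
      by (intro AE_I2 ennreal_leI sample_le(1)[OF m])
    show "AE t in spectral_measure E x. (\<lambda>n. ennreal ((cmod (step_fun (sample f n (m n)) t))\<^sup>2))
        \<longlonglongrightarrow> ennreal ((cmod (f t))\<^sup>2)"
      by (intro AE_I2 tendsto_intros sample_tendsto[OF m])
  qed simp_all
qed

end


section \<open>Continuous functions of the operator\<close>

context
  fixes E :: "real \<Rightarrow> 'a::{complex_inner, complete_space} \<Rightarrow> 'a"
  assumes sf: "spectral_family E"
begin

text \<open>
  The approximating sequence does not depend on \<open>x\<close>; linearity of \<open>f(A)\<close> and comparisons between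
  different functions of \<open>A\<close> rest on this.
\<close>

lemma step_integral_sample_tendsto:
  assumes f: "continuous_on UNIV f" and m: "fine_mesh f m" and x: "x \<in> spectral_dom E f"
  shows "(\<lambda>n. step_integral E (sample f n (m n)) x) \<longlonglongrightarrow> spectral_op E f x"
proof -
  let ?I = "\<lambda>n. step_integral E (sample f n (m n)) x"
  let ?e = "\<lambda>n. \<integral>\<^sup>+ t. ennreal ((cmod (f t - step_fun (sample f n (m n)) t))\<^sup>2) \<partial>spectral_measure E x"
  have meas: "f \<in> borel_measurable borel"
    using f by (rule borel_measurable_continuous_onI)
  have zero_le_r: "0 \<le> r\<^sup>2 / 8" for r :: real
    by simp
  have two_times: "ennreal (2 * c) = 2 * ennreal c" if "0 \<le> c" for c
    using that by (simp add: ennreal_mult)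
  have "Cauchy ?I"
  proof (rule metric_CauchyI)
    fix r :: real assume r: "0 < r"
    then have "0 < ennreal (r\<^sup>2 / 8)"
      by simp
    from order_tendstoD(2)[OF sample_L2(1)[OF sf f m x] this]
    obtain N where N: "\<And>n. n \<ge> N \<Longrightarrow> ?e n < ennreal (r\<^sup>2 / 8)"
      by (auto simp: eventually_sequentially)
    have "dist (?I k) (?I n) < r" if "k \<ge> N" "n \<ge> N" for k n
    proof -
      have "ennreal ((norm (?I k - ?I n))\<^sup>2) \<le> 2 * ?e k + 2 * ?e n"
        by (rule step_integral_dist[OF sf meas valid_sample valid_sample])
      also have "\<dots> \<le> 2 * ennreal (r\<^sup>2 / 8) + 2 * ennreal (r\<^sup>2 / 8)"
        using N[OF that(1)] N[OF that(2)] by (intro add_mono mult_left_mono) auto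
      also have "\<dots> = ennreal (2 * (r\<^sup>2 / 8)) + ennreal (2 * (r\<^sup>2 / 8))"
        by (simp only: two_times[OF zero_le_r])
      also have "\<dots> = ennreal (2 * (r\<^sup>2 / 8) + 2 * (r\<^sup>2 / 8))"
        by (rule ennreal_plus[symmetric]) simp_all
      finally have "ennreal ((norm (?I k - ?I n))\<^sup>2) \<le> ennreal (r\<^sup>2 / 2)"
        by (simp add: field_simps)
      then have "(norm (?I k - ?I n))\<^sup>2 \<le> r\<^sup>2 / 2"
        by simp
      also have "\<dots> < r\<^sup>2"
        using r by simp
      finally have "(norm (?I k - ?I n))\<^sup>2 < r\<^sup>2" .
      then show ?thesis
        using power_less_imp_less_base[of _ 2 r] r by (simp only: dist_norm)
    qed
    then show "\<exists>N. \<forall>k\<ge>N. \<forall>n\<ge>N. dist (?I k) (?I n) < r"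
      by blast
  qed
  then obtain v where v: "?I \<longlonglongrightarrow> v"
    by (auto simp: Cauchy_convergent_iff convergent_def)
  have "has_spectral_integral E f x v"
    unfolding has_spectral_integral_def
    by (intro exI[of _ "\<lambda>n. sample f n (m n)"] conjI allI valid_sample v sample_L2(1)[OF sf f m x])
  then have "spectral_op E f x = v"
    by (rule spectral_op_eqI[OF sf meas])
  with v show ?thesis
    by simp
qed

lemma norm_spectral_op:
  assumes f: "continuous_on UNIV f" and x: "x \<in> spectral_dom E f"
  shows "ennreal ((norm (spectral_op E f x))\<^sup>2) = (\<integral>\<^sup>+ t. ennreal ((cmod (f t))\<^sup>2) \<partial>spectral_measure E x)"
proof -
  obtain m where m: "fine_mesh f m"
    using fine_mesh_exists[OF f] ..
  have "(\<lambda>n. ennreal ((norm (step_integral E (sample f n (m n)) x))\<^sup>2))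
      \<longlonglongrightarrow> ennreal ((norm (spectral_op E f x))\<^sup>2)"
    by (intro tendsto_intros step_integral_sample_tendsto f m x)
  then show ?thesis
    using sample_L2(2)[OF sf f m x] unfolding norm_step_integral[OF sf valid_sample]
    by (rule LIMSEQ_unique)
qed

lemma step_integral_add: "step_integral E L (x + y) = step_integral E L x + step_integral E L y"
  by (induction L) (auto simp: step_integral_def E_add[OF sf] algebra_simps scaleC_add_right
      complex_vector.scale_right_diff_distrib)

lemma step_integral_scaleC: "step_integral E L (c *\<^sub>C x) = c *\<^sub>C step_integral E L x"
  by (induction L) (auto simp: step_integral_def E_scaleC[OF sf] scaleC_add_right scaleC_scaleC
      complex_vector.scale_right_diff_distrib mult.commute)

lemma spectral_op_add:
  assumes f: "continuous_on UNIV f"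
    and "x \<in> spectral_dom E f" and "y \<in> spectral_dom E f" and "x + y \<in> spectral_dom E f"
  shows "spectral_op E f (x + y) = spectral_op E f x + spectral_op E f y"
proof -
  obtain m where m: "fine_mesh f m"
    using fine_mesh_exists[OF f] ..
  show ?thesis
    using step_integral_sample_tendsto[OF f m assms(4)]
      tendsto_add[OF step_integral_sample_tendsto[OF f m assms(2)]
        step_integral_sample_tendsto[OF f m assms(3)]]
    unfolding step_integral_add by (rule LIMSEQ_unique)
qed

lemma spectral_op_scaleC:
  assumes f: "continuous_on UNIV f"
    and "x \<in> spectral_dom E f" and "c *\<^sub>C x \<in> spectral_dom E f"
  shows "spectral_op E f (c *\<^sub>C x) = c *\<^sub>C spectral_op E f x"
proof -
  obtain m where m: "fine_mesh f m"
    using fine_mesh_exists[OF f] ..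
  show ?thesis
    using step_integral_sample_tendsto[OF f m assms(3)]
      tendsto_scaleC[OF step_integral_sample_tendsto[OF f m assms(2)]]
    unfolding step_integral_scaleC by (rule LIMSEQ_unique)
qed

lemma bounded_AE_spectral_op:
  assumes f: "continuous_on UNIV f" and B: "0 \<le> B"
    and le: "AE t in spectral_measure E x. cmod (f t) \<le> B"
  shows "x \<in> spectral_dom E f" and "norm (spectral_op E f x) \<le> B * norm x"
proof -
  have "(\<integral>\<^sup>+ t. ennreal ((cmod (f t))\<^sup>2) \<partial>spectral_measure E x)
      \<le> (\<integral>\<^sup>+ t. ennreal (B\<^sup>2) \<partial>spectral_measure E x)"
    by (rule nn_integral_mono_AE, use le in eventually_elim)
      (intro ennreal_leI power_mono norm_ge_zero)
  also have "\<dots> = ennreal ((B * norm x)\<^sup>2)"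
    by (simp add: emeasure_UNIV[OF sf] ennreal_mult power_mult_distrib)
  finally have *: "(\<integral>\<^sup>+ t. ennreal ((cmod (f t))\<^sup>2) \<partial>spectral_measure E x) \<le> ennreal ((B * norm x)\<^sup>2)" .
  show dom: "x \<in> spectral_dom E f"
    using le_less_trans[OF * ennreal_less_top] by (simp add: spectral_dom_def)
  have "(norm (spectral_op E f x))\<^sup>2 \<le> (B * norm x)\<^sup>2"
    using * unfolding norm_spectral_op[OF f dom, symmetric] by (subst (asm) ennreal_le_iff) auto
  then show "norm (spectral_op E f x) \<le> B * norm x"
    by (rule power2_le_imp_le) (simp add: B)
qed

lemma bounded_below_AE_spectral_op:
  assumes f: "continuous_on UNIV f" and dom: "x \<in> spectral_dom E f" and b: "0 \<le> b"
    and le: "AE t in spectral_measure E x. b \<le> cmod (f t)"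
  shows "b * norm x \<le> norm (spectral_op E f x)"
proof (rule power2_le_imp_le)
  have "ennreal ((b * norm x)\<^sup>2) = (\<integral>\<^sup>+ t. ennreal (b\<^sup>2) \<partial>spectral_measure E x)"
    by (simp add: emeasure_UNIV[OF sf] ennreal_mult power_mult_distrib)
  also have "\<dots> \<le> (\<integral>\<^sup>+ t. ennreal ((cmod (f t))\<^sup>2) \<partial>spectral_measure E x)"
    by (rule nn_integral_mono_AE, use le in eventually_elim) (intro ennreal_leI power_mono b)
  finally show "(b * norm x)\<^sup>2 \<le> (norm (spectral_op E f x))\<^sup>2"
    unfolding norm_spectral_op[OF f dom, symmetric] by (subst (asm) ennreal_le_iff) auto
qed simp

lemma bounded_function_bounded_operator:
  assumes f: "continuous_on UNIV f" and B: "\<And>t. cmod (f t) \<le> B"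
  shows "spectral_op E f \<in> bounded_operators"
proof -
  have B0: "0 \<le> B"
    using order_trans[OF norm_ge_zero B] .
  have dom: "x \<in> spectral_dom E f" and le: "norm (spectral_op E f x) \<le> B * norm x" for x
    using bounded_AE_spectral_op[OF f B0, of x] B by auto
  have add: "spectral_op E f (x + y) = spectral_op E f x + spectral_op E f y" for x y
    by (rule spectral_op_add[OF f dom dom dom])
  have scale: "spectral_op E f (c *\<^sub>C x) = c *\<^sub>C spectral_op E f x" for c x
    by (rule spectral_op_scaleC[OF f dom dom])
  have "bounded_linear (spectral_op E f)"
    by (rule bounded_linear_intro[where K = B])
      (simp_all add: add scale scaleR_scaleC le mult.commute)
  moreover have "clinear (spectral_op E f)"
    by (simp add: Vector_Spaces.linear_iff add scale complex_vector.vector_space_axioms)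
  ultimately show ?thesis
    by (simp add: bounded_operators_def)
qed

text \<open>
  The spectral measure of \<open>0\<close> vanishes.
\<close>

lemma spectral_dom_zero: "0 \<in> spectral_dom E f"
proof -
  have "emeasure (spectral_measure E 0) UNIV = 0"
    by (simp add: emeasure_UNIV[OF sf])
  then have "AE t in spectral_measure E 0. ennreal ((cmod (f t))\<^sup>2) = 0"
    by (intro AE_I[where N = UNIV]) auto
  then have "(\<integral>\<^sup>+ t. ennreal ((cmod (f t))\<^sup>2) \<partial>spectral_measure E 0)
      = (\<integral>\<^sup>+ t. 0 \<partial>spectral_measure E 0)"
    by (rule nn_integral_cong_AE)
  then show ?thesis
    by (simp add: spectral_dom_def)
qed

lemma spectral_op_minus:
  assumes f: "continuous_on UNIV f" and x: "x \<in> spectral_dom E f"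
  shows "- x \<in> spectral_dom E f" and "spectral_op E f (- x) = - spectral_op E f x"
proof -
  have neg: "- y = (-1) *\<^sub>C y" for y :: 'a
    by simp
  have "cinner (E s (- x)) (- x) = cinner (E s x) x" for s
    unfolding neg[of x] E_scaleC[OF sf] by (simp add: cinner_scaleC_left cinner_scaleC_right
        del: complex_vector.scale_minus_left)
  then have "spectral_measure E (- x) = spectral_measure E x"
    by (simp add: spectral_measure_def)
  with x show dom: "- x \<in> spectral_dom E f"
    by (simp add: spectral_dom_def)
  show "spectral_op E f (- x) = - spectral_op E f x"
    using spectral_op_scaleC[OF f x, of "-1"] dom by simp
qed

text \<open>
  The interval \<open>{s..<t}\<close> has mass \<open>\<parallel>(E\<^sub>t - E\<^sub>s) x\<parallel>\<^sup>2 = \<parallel>x\<parallel>\<^sup>2\<close>, which is the total mass.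
\<close>

lemma AE_spectral_interval:
  assumes "s \<le> t" and x: "E t x - E s x = x"
  shows "AE r in spectral_measure E x. r \<in> {s..<t}"
proof -
  interpret finite_measure "spectral_measure E x"
    by (rule finite_spectral_measure[OF sf])
  have "measure (spectral_measure E x) (UNIV - {s..<t})
      = measure (spectral_measure E x) UNIV - measure (spectral_measure E x) {s..<t}"
    using finite_measure_compl[of "{s..<t}"] by simp
  also have "measure (spectral_measure E x) UNIV = (norm x)\<^sup>2"
    by (simp add: measure_def emeasure_UNIV[OF sf])
  also have "measure (spectral_measure E x) {s..<t} = (norm x)\<^sup>2"
    using norm_increment[OF sf assms(1), of x] spectral_measure_Ico[OF sf assms(1), of x] x by simp
  finally have "emeasure (spectral_measure E x) (UNIV - {s..<t}) = 0"
    by (simp add: emeasure_eq_measure)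
  then show ?thesis
    by (intro AE_I[where N = "UNIV - {s..<t}"]) auto
qed

text \<open>
  Increments of \<open>E\<close> over disjoint intervals have orthogonal ranges.
\<close>

lemma norm_sum_increments:
  assumes p: "\<And>i j. i \<le> j \<Longrightarrow> p i \<le> (p j :: real)"
  shows "(norm (\<Sum>i<N. E (p (Suc i)) (y i) - E (p i) (y i)))\<^sup>2
    = (\<Sum>i<N. (norm (E (p (Suc i)) (y i) - E (p i) (y i)))\<^sup>2)"
proof (rule norm_sum_Pythagorean)
  have orth: "cinner (E (p (Suc i)) u - E (p i) u) (E (p (Suc j)) v - E (p j) v) = 0"
    if "i < j" for i j u v
  proof -
    have le: "p i \<le> p (Suc i)" "p (Suc i) \<le> p j" "p j \<le> p (Suc j)"
      using that by (auto intro: p)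
    then have "min (p (Suc i)) (p (Suc j)) = p (Suc i)" "min (p (Suc i)) (p j) = p (Suc i)"
      "min (p i) (p (Suc j)) = p i" "min (p i) (p j) = p i"
      by auto
    then show ?thesis
      by (simp add: cinner_diff_left cinner_diff_right cinner_E_E[OF sf])
  qed
  show "pairwise (\<lambda>i j. orthogonal (E (p (Suc i)) (y i) - E (p i) (y i))
      (E (p (Suc j)) (y j) - E (p j) (y j))) {..<N}"
    unfolding pairwise_def orthogonal_def
  proof safe
    fix i j :: nat
    assume "i \<noteq> j"
    then consider "i < j" | "j < i"
      by linarith
    then show "inner (E (p (Suc i)) (y i) - E (p i) (y i)) (E (p (Suc j)) (y j) - E (p j) (y j)) = 0"
    proof cases
      case 1
      then show ?thesis
        by (simp add: inner_eq_Re_cinner orth)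
    next
      case 2
      then show ?thesis
        by (subst inner_commute) (simp add: inner_eq_Re_cinner orth)
    qed
  qed
qed simp

lemma sum_increments_le:
  assumes p: "\<And>i j. i \<le> j \<Longrightarrow> p i \<le> (p j :: real)"
  shows "(\<Sum>i<N. (norm (E (p (Suc i)) u - E (p i) u))\<^sup>2) \<le> (norm u)\<^sup>2"
proof -
  have "(\<Sum>i<N. (norm (E (p (Suc i)) u - E (p i) u))\<^sup>2)
      = (\<Sum>i<N. (norm (E (p (Suc i)) u))\<^sup>2 - (norm (E (p i) u))\<^sup>2)"
    by (intro sum.cong norm_increment[OF sf] p) auto
  also have "\<dots> = (norm (E (p N) u))\<^sup>2 - (norm (E (p 0) u))\<^sup>2"
    by (rule sum_lessThan_telescope)
  also have "\<dots> \<le> (norm u)\<^sup>2"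
    using power_mono[OF norm_E_le[OF sf, of "p N" u] norm_ge_zero, of 2]
      zero_le_power2[of "norm (E (p 0) u)"] by linarith
  finally show ?thesis .
qed

end


section \<open>The recovery operator\<close>

lemma weighted_square_le:
  fixes a w p q :: real
  assumes "0 \<le> a" and "0 \<le> w"
  shows "(w * p + a * q)\<^sup>2 \<le> (a + w) * (w * p\<^sup>2 + a * q\<^sup>2)"
proof -
  have "(a + w) * (w * p\<^sup>2 + a * q\<^sup>2) - (w * p + a * q)\<^sup>2 = (a * w) * (p - q)\<^sup>2"
    by (simp add: power2_eq_square algebra_simps)
  also have "\<dots> \<ge> 0"
    using assms by simp
  finally show ?thesis
    by simp
qed

text \<open>
  The pointwise core of the upper bound. For \<open>s = a + w \<noteq> 0\<close> the vector equals
  \<open>(c / s) (w X + a U)\<close>; the weighted Cauchy-Schwarz inequality bounds \<open>\<parallel>w X + a U\<parallel>\<^sup>2\<close> by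
  \<open>s (w \<parallel>X\<parallel>\<^sup>2 + a \<parallel>U\<parallel>\<^sup>2)\<close>, and the factor \<open>|c|\<^sup>2 / s\<close> is at most \<open>1\<close>.
\<close>

lemma norm_weighted_combination:
  fixes X U :: "'a::complex_inner" and a w :: real
  assumes a: "0 \<le> a" and w: "0 \<le> w" and c: "(cmod c)\<^sup>2 \<le> a + w"
  shows "(norm ((c - c * complex_of_real (a / (a + w))) *\<^sub>C X
      + (c * complex_of_real (a / (a + w))) *\<^sub>C U))\<^sup>2 \<le> w * (norm X)\<^sup>2 + a * (norm U)\<^sup>2"
proof (cases "a + w = 0")
  case True
  with c have "c = 0"
    by simp
  then show ?thesis
    using a w by simp
next
  case False
  with a w have s: "0 < a + w"
    by linarith
  have cw: "c - c * complex_of_real (a / (a + w)) = c * complex_of_real (w / (a + w))"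
  proof -
    have "complex_of_real (w / (a + w)) = complex_of_real (1 - a / (a + w))"
      using False by (simp only: of_real_eq_iff) (simp add: field_simps)
    then show ?thesis
      by (simp only: of_real_diff of_real_1 right_diff_distrib mult_1_right)
  qed
  let ?v = "(c - c * complex_of_real (a / (a + w))) *\<^sub>C X + (c * complex_of_real (a / (a + w))) *\<^sub>C U"
  have "norm ?v \<le> cmod c * (w / (a + w)) * norm X + cmod c * (a / (a + w)) * norm U"
    unfolding cw using a w by (intro norm_triangle_le add_mono) (simp_all add: norm_scaleC norm_mult
        flip: of_real_add of_real_divide)
  also have "\<dots> = cmod c / (a + w) * (w * norm X + a * norm U)"
    by (simp add: algebra_simps add_divide_distrib)
  finally have "(norm ?v)\<^sup>2 \<le> (cmod c / (a + w) * (w * norm X + a * norm U))\<^sup>2"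
    by (intro power_mono) auto
  also have "\<dots> = (cmod c)\<^sup>2 / (a + w)\<^sup>2 * (w * norm X + a * norm U)\<^sup>2"
    by (simp add: power_mult_distrib power_divide)
  also have "\<dots> \<le> (a + w) / (a + w)\<^sup>2 * ((a + w) * (w * (norm X)\<^sup>2 + a * (norm U)\<^sup>2))"
    using c s by (intro mult_mono divide_right_mono weighted_square_le a w) auto
  also have "\<dots> = w * (norm X)\<^sup>2 + a * (norm U)\<^sup>2"
    using s by (simp add: power2_eq_square)
  finally show ?thesis .
qed

text \<open>
  The function \<open>g\<close> for which \<open>g(A)\<close> recovers \<open>\<phi>(A)\<close> from inexact data. For \<open>a = 0\<close> it is \<open>0\<close>,
  division by \<open>0\<close> included; this is the optimal choice when \<open>F\<close> is linear up to \<open>1 / \<delta>\<^sup>2\<close>.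
\<close>

definition recovery_symbol :: "(real \<Rightarrow> complex) \<Rightarrow> (real \<Rightarrow> complex) \<Rightarrow> real \<Rightarrow> real \<Rightarrow> real \<Rightarrow> complex" where
  "recovery_symbol \<phi> \<psi> a k t = \<phi> t * complex_of_real (a / (a + k * (cmod (\<psi> t))\<^sup>2))"

lemma recovery_symbol_continuous:
  assumes "continuous_on UNIV \<phi>" and "continuous_on UNIV \<psi>" and a: "0 \<le> a" and k: "0 \<le> k"
  shows "continuous_on UNIV (recovery_symbol \<phi> \<psi> a k)"
proof (cases "a = 0")
  case False
  then have "a + k * (cmod (\<psi> t))\<^sup>2 \<noteq> 0" for t
    using a k by (metis add_nonneg_eq_0_iff mult_nonneg_nonneg zero_le_power2)
  then show ?thesis
    unfolding recovery_symbol_def[abs_def] by (intro continuous_intros assms ballI)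
qed (simp add: recovery_symbol_def[abs_def])

lemma recovery_symbol_bounded:
  assumes a: "0 \<le> a" and k: "0 \<le> k" and le: "(cmod (\<phi> t))\<^sup>2 \<le> a + k * (cmod (\<psi> t))\<^sup>2"
  shows "cmod (recovery_symbol \<phi> \<psi> a k t) \<le> sqrt a"
proof (rule real_le_rsqrt)
  define w where "w = a + k * (cmod (\<psi> t))\<^sup>2"
  have w: "a \<le> w" "(cmod (\<phi> t))\<^sup>2 \<le> w"
    using k le by (simp_all add: w_def)
  have "(cmod (recovery_symbol \<phi> \<psi> a k t))\<^sup>2 = (cmod (\<phi> t))\<^sup>2 * (a / w)\<^sup>2"
    using a w by (simp add: recovery_symbol_def w_def norm_mult norm_divide power_mult_distrib
        power_divide flip: of_real_add of_real_mult of_real_power of_real_divide)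
  also have "\<dots> \<le> w * (a / w)\<^sup>2"
    using w(2) by (rule mult_right_mono) simp
  also have "\<dots> = a * (a / w)"
    by (simp add: power2_eq_square)
  also have "\<dots> \<le> a * 1"
    using a w(1) by (intro mult_left_mono) (auto simp: divide_le_eq_1)
  finally show "(cmod (recovery_symbol \<phi> \<psi> a k t))\<^sup>2 \<le> a"
    by simp
qed

context
  fixes E :: "real \<Rightarrow> 'a::{complex_inner, complete_space} \<Rightarrow> 'a"
  assumes sf: "spectral_family E"
begin

lemma spectral_dom_mono:
  assumes psi: "continuous_on UNIV \<psi>" and a: "0 \<le> a" and k: "0 \<le> k"
    and le: "\<And>t. (cmod (\<phi> t))\<^sup>2 \<le> a + k * (cmod (\<psi> t))\<^sup>2"
  shows "spectral_dom E \<psi> \<subseteq> spectral_dom E \<phi>"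
proof
  fix x assume x: "x \<in> spectral_dom E \<psi>"
  have [measurable]: "\<psi> \<in> borel_measurable borel"
    using psi by (rule borel_measurable_continuous_onI)
  have "(\<integral>\<^sup>+ t. ennreal ((cmod (\<phi> t))\<^sup>2) \<partial>spectral_measure E x)
      \<le> (\<integral>\<^sup>+ t. ennreal a + ennreal k * ennreal ((cmod (\<psi> t))\<^sup>2) \<partial>spectral_measure E x)"
  proof (rule nn_integral_mono)
    fix t
    show "ennreal ((cmod (\<phi> t))\<^sup>2) \<le> ennreal a + ennreal k * ennreal ((cmod (\<psi> t))\<^sup>2)"
      using ennreal_leI[OF le[of t]] a k by (simp add: ennreal_plus ennreal_mult)
  qed
  also have "\<dots> = ennreal a * emeasure (spectral_measure E x) UNIV
      + ennreal k * (\<integral>\<^sup>+ t. ennreal ((cmod (\<psi> t))\<^sup>2) \<partial>spectral_measure E x)"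
    by (subst nn_integral_add) (simp_all add: nn_integral_cmult)
  also have "\<dots> < \<infinity>"
    using x by (simp add: spectral_dom_def emeasure_UNIV[OF sf] ennreal_mult_less_top)
  finally show "x \<in> spectral_dom E \<phi>"
    by (simp add: spectral_dom_def)
qed

text \<open>
  Sample \<open>\<phi>\<close>, \<open>\<psi>\<close> and \<open>g\<close> at common nodes. The error then splits into orthogonal parts, one for
  each cell, to which \<open>norm_weighted_combination\<close> applies with \<open>c\<close> a value of \<open>\<phi>\<close>, and the
  resulting sums are \<open>\<parallel>\<psi>(A) x\<parallel>\<^sup>2\<close> for the sampled \<open>\<psi>\<close> and at most \<open>\<parallel>x - \<eta>\<parallel>\<^sup>2\<close>.
\<close>

lemma recovery_estimate:
  assumes phi: "continuous_on UNIV \<phi>" and psi: "continuous_on UNIV \<psi>" and a: "0 \<le> a" and k: "0 \<le> k"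
    and le: "\<And>t. (cmod (\<phi> t))\<^sup>2 \<le> a + k * (cmod (\<psi> t))\<^sup>2"
    and x: "x \<in> spectral_dom E \<psi>"
  shows "(norm (spectral_op E \<phi> x - spectral_op E (recovery_symbol \<phi> \<psi> a k) \<eta>))\<^sup>2
    \<le> k * (norm (spectral_op E \<psi> x))\<^sup>2 + a * (norm (x - \<eta>))\<^sup>2"
proof -
  let ?g = "recovery_symbol \<phi> \<psi> a k"
  have g: "continuous_on UNIV ?g"
    by (rule recovery_symbol_continuous[OF phi psi a k])
  obtain m where m: "fine_mesh (\<lambda>t. (\<phi> t, \<psi> t, ?g t)) m"
    using fine_mesh_exists[OF continuous_on_Pair[OF phi continuous_on_Pair[OF psi g]]] ..
  have m_phi: "fine_mesh \<phi> m" and m_psi: "fine_mesh \<psi> m" and m_g: "fine_mesh ?g m"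
    using fine_mesh_fst[OF m] fine_mesh_fst[OF fine_mesh_snd[OF m]]
      fine_mesh_snd[OF fine_mesh_snd[OF m]] by auto
  have x_phi: "x \<in> spectral_dom E \<phi>"
    using spectral_dom_mono[OF psi a k le] x by blast
  have eta: "\<eta> \<in> spectral_dom E ?g"
    by (rule bounded_AE_spectral_op(1)[OF sf g, of "sqrt a"])
      (use a in \<open>auto intro!: AE_I2 recovery_symbol_bounded k le\<close>)
  let ?S = "\<lambda>f n. step_integral E (sample f n (m n))"
  have bound: "(norm (?S \<phi> n x - ?S ?g n \<eta>))\<^sup>2 \<le> k * (norm (?S \<psi> n x))\<^sup>2 + a * (norm (x - \<eta>))\<^sup>2" for n
  proof -
    let ?p = "node n (m n)" and ?N = "2 * n * m n"
    let ?P = "\<lambda>i u. E (?p (Suc i)) u - E (?p i) u"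
    \<comment> \<open>\<open>y i\<close> is \<open>\<phi> x - g \<eta>\<close> with the functions evaluated at the node \<open>?p i\<close>\<close>
    define y where "y i = (\<phi> (?p i) - ?g (?p i)) *\<^sub>C x + ?g (?p i) *\<^sub>C (x - \<eta>)" for i
    have P_y: "?P i (y i) = (\<phi> (?p i) - ?g (?p i)) *\<^sub>C ?P i x + ?g (?p i) *\<^sub>C ?P i (x - \<eta>)" for i
      unfolding y_def E_add[OF sf] E_scaleC[OF sf]
      by (simp add: algebra_simps complex_vector.scale_right_diff_distrib)
    have "?S \<phi> n x - ?S ?g n \<eta> = (\<Sum>i<?N. ?P i (y i))"
      unfolding step_integral_sample sum_subtractf[symmetric] P_y
      by (intro sum.cong)
        (simp_all add: E_diff[OF sf] complex_vector.scale_right_diff_distrib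
          complex_vector.scale_left_diff_distrib)
    then have "(norm (?S \<phi> n x - ?S ?g n \<eta>))\<^sup>2 = (\<Sum>i<?N. (norm (?P i (y i)))\<^sup>2)"
      by (simp only: norm_sum_increments[OF sf, where p = ?p and y = y and N = ?N, OF node_mono])
    also have "\<dots> \<le> (\<Sum>i<?N. k * (cmod (\<psi> (?p i)))\<^sup>2 * (norm (?P i x))\<^sup>2 + a * (norm (?P i (x - \<eta>)))\<^sup>2)"
      unfolding P_y recovery_symbol_def using k
      by (intro sum_mono norm_weighted_combination a le) auto
    also have "\<dots> = k * (\<Sum>i<?N. (norm (\<psi> (?p i) *\<^sub>C ?P i x))\<^sup>2) + a * (\<Sum>i<?N. (norm (?P i (x - \<eta>)))\<^sup>2)"
      by (simp add: sum.distrib sum_distrib_left norm_scaleC power_mult_distrib mult.assoc)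
    also have "(\<Sum>i<?N. (norm (\<psi> (?p i) *\<^sub>C ?P i x))\<^sup>2) = (norm (?S \<psi> n x))\<^sup>2"
      using norm_sum_increments[OF sf, where p = ?p and y = "\<lambda>i. \<psi> (?p i) *\<^sub>C x" and N = ?N, OF node_mono]
      by (simp add: step_integral_sample E_scaleC[OF sf] complex_vector.scale_right_diff_distrib)
    also have "(\<Sum>i<?N. (norm (?P i (x - \<eta>)))\<^sup>2) \<le> (norm (x - \<eta>))\<^sup>2"
      by (rule sum_increments_le[OF sf node_mono])
    finally show ?thesis
      using a by (simp add: mult_left_mono)
  qed
  have lhs: "(\<lambda>n. (norm (?S \<phi> n x - ?S ?g n \<eta>))\<^sup>2)
      \<longlonglongrightarrow> (norm (spectral_op E \<phi> x - spectral_op E ?g \<eta>))\<^sup>2"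
    by (intro tendsto_intros step_integral_sample_tendsto[OF sf] phi g m_phi m_g x_phi eta)
  have rhs: "(\<lambda>n. k * (norm (?S \<psi> n x))\<^sup>2 + a * (norm (x - \<eta>))\<^sup>2)
      \<longlonglongrightarrow> k * (norm (spectral_op E \<psi> x))\<^sup>2 + a * (norm (x - \<eta>))\<^sup>2"
    by (intro tendsto_intros step_integral_sample_tendsto[OF sf] psi m_psi x)
  show ?thesis
    by (rule LIMSEQ_le[OF lhs rhs]) (use bound in blast)
qed

end


section \<open>Optimal recovery\<close>

text \<open>
  An observation \<open>\<eta> = 0\<close> cannot distinguish \<open>x\<close> from \<open>- x\<close>, and the two values to be recovered
  are \<open>2 \<parallel>S x\<parallel>\<close> apart.
\<close>

lemma modulus_le_recovery_error:
  fixes S :: "'a::real_normed_vector \<Rightarrow> 'a"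
  assumes W: "\<And>x. x \<in> W \<Longrightarrow> - x \<in> W" and S: "\<And>x. x \<in> W \<Longrightarrow> S (- x) = - S x"
  shows "modulus_of_continuity S W \<delta> \<le> recovery_error \<delta> R S W"
  unfolding modulus_of_continuity_def recovery_error_def
proof (intro INF_greatest SUP_least)
  fix T :: "'a \<Rightarrow> 'a" and x
  let ?Z = "{(x, \<eta>). x \<in> W \<and> norm (x - \<eta>) \<le> \<delta>}"
  assume "x \<in> {x \<in> W. norm x \<le> \<delta>}"
  then have x: "x \<in> W" and Z: "(x, 0) \<in> ?Z" "(- x, 0) \<in> ?Z"
    using W by auto
  have "ereal (norm (S x)) \<le> ereal (max (norm (S x - T 0)) (norm (S (- x) - T 0)))"
  proof -
    have "2 * norm (S x) = norm ((S x - T 0) - (S (- x) - T 0))"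
      by (simp add: S[OF x] flip: scaleR_2)
    also have "\<dots> \<le> norm (S x - T 0) + norm (S (- x) - T 0)"
      by (rule norm_triangle_ineq4)
    finally have "norm (S x) \<le> max (norm (S x - T 0)) (norm (S (- x) - T 0))"
      by linarith
    then show ?thesis
      by (simp only: ereal_less_eq)
  qed
  also have "\<dots> \<le> (SUP (x, \<eta>)\<in>?Z. ereal (norm (S x - T \<eta>)))"
    using SUP_upper[OF Z(1), of "\<lambda>(x, \<eta>). ereal (norm (S x - T \<eta>))"]
      SUP_upper[OF Z(2), of "\<lambda>(x, \<eta>). ereal (norm (S x - T \<eta>))"]
    by (auto simp: max_def)
  finally show "ereal (norm (S x)) \<le> (SUP (x, \<eta>)\<in>?Z. ereal (norm (S x - T \<eta>)))" .
qed

text \<open>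
  The slope is one-sided: the infimum of the difference quotients of the convex function \<open>- F\<close> to
  the right of \<open>y0\<close>, up to sign. Monotonicity makes it nonnegative, and the line at \<open>0\<close> gives the
  bound on \<open>k * y0\<close>.
\<close>

lemma concave_supporting_line:
  fixes F :: "real \<Rightarrow> real"
  assumes "concave_on {0..} F" and mono: "strict_mono_on {0..} F" and "F 0 = 0" and y0: "0 < y0"
  obtains k where "0 \<le> k" and "k * y0 \<le> F y0" and "\<And>y. 0 \<le> y \<Longrightarrow> F y \<le> F y0 + k * (y - y0)"
proof -
  define k where "k = - Inf ((\<lambda>t. (- F y0 - - F t) / (y0 - t)) ` ({y0<..} \<inter> {0..}))"
  have "convex_on {0..} (\<lambda>y. - F y)"
    using assms(1) by (simp add: concave_on_def)
  moreover have "y0 \<in> interior {0..}"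
    using y0 by (simp add: interior_real_atLeast)
  ultimately have line: "F y \<le> F y0 + k * (y - y0)" if "0 \<le> y" for y
    using convex_le_Inf_differential[of "{0..}" "\<lambda>y. - F y" y0 y] that by (simp add: k_def)
  have "0 \<le> k"
    using line[of "y0 + 1"] strict_mono_onD[OF mono, of y0 "y0 + 1"] y0 by simp
  moreover have "k * y0 \<le> F y0"
    using line[of 0] assms(3) by simp
  ultimately show thesis
    using line by (rule that)
qed

lemma mono_on_nonneg_of_strict_mono_on_pos:
  fixes h :: "real \<Rightarrow> real"
  assumes h: "continuous_on UNIV h" and mono: "strict_mono_on {0<..} h" and "0 \<le> s" and "s \<le> t"
  shows "h s \<le> h t"
proof (cases "s = t \<or> 0 < s")
  case True
  then show ?thesis
    using strict_mono_onD[OF mono, of s t] assms by fastforce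
next
  case False
  with assms have st: "s = 0" "0 < t"
    by auto
  have "isCont h 0"
    using h by (simp add: continuous_on_eq_continuous_at)
  then have "(h \<longlongrightarrow> h 0) (at_right 0)"
    by (simp add: isCont_def filterlim_at_split)
  moreover have "\<forall>\<^sub>F r in at_right 0. h r \<le> h t"
    using eventually_at_right_real[OF st(2)]
    by eventually_elim (use strict_mono_onD[OF mono] in \<open>auto intro!: less_imp_le\<close>)
  ultimately show ?thesis
    unfolding st by (intro tendsto_upperbound[of h _ "at_right 0"]) auto
qed

theorem theorem8:
  fixes D :: "'a::{complex_inner, complete_space} set"
    and A :: "'a \<Rightarrow> 'a"
    and E :: "real \<Rightarrow> 'a \<Rightarrow> 'a"
    and \<phi> \<psi> :: "real \<Rightarrow> complex"
    and F :: "real \<Rightarrow> real"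
    and R :: "('a \<Rightarrow> 'a) set"
    and \<delta> :: real
  assumes "self_adjoint_on D A"
    and "partition_of_unity_of E D A"
    and "continuous_on UNIV \<phi>" and "continuous_on UNIV \<psi>"
    and "\<And>t. cmod (\<phi> (- t)) = cmod (\<phi> t)" and "\<And>t. cmod (\<psi> (- t)) = cmod (\<psi> t)"
    and "strict_mono_on {0<..} (\<lambda>t. cmod (\<phi> t))"
    and "strict_mono_on {0<..} (\<lambda>t. cmod (\<psi> t))"
    and "filterlim (\<lambda>t. cmod (\<phi> t)) at_top at_top"
    and "filterlim (\<lambda>t. cmod (\<psi> t)) at_top at_top"
    and "strict_mono_on {0..} F" and "concave_on {0..} F" and "F 0 = 0"
    and "\<And>t. (cmod (\<phi> t))\<^sup>2 = F ((cmod (\<psi> t))\<^sup>2)"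
    and "\<And>s t :: ereal. 0 \<le> s \<Longrightarrow> s < t \<Longrightarrow>
           (\<lambda>x. ext_family E t x - ext_family E s x) ` spectral_dom E \<psi> \<noteq> {0}"
    and "R \<in> {all_mappings, bounded_operators, linear_operators}"
    and "\<delta> > 0" and "cmod (\<psi> 0) * \<delta> \<le> 1"
  shows "recovery_error \<delta> R (spectral_op E \<phi>) (W_class E \<psi>)
           = modulus_of_continuity (spectral_op E \<phi>) (W_class E \<psi>) \<delta> \<and>
         modulus_of_continuity (spectral_op E \<phi>) (W_class E \<psi>) \<delta>
           = ereal (\<delta> * sqrt (F (1 / \<delta>\<^sup>2)))"
proof -
  note phi = assms(3) and psi = assms(4) and F_eq = assms(14) and \<delta> = assms(17)
  let ?\<Phi> = "spectral_op E \<phi>" and ?\<Psi> = "spectral_op E \<psi>" and ?W = "W_class E \<psi>"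
  have sf: "spectral_family E"
    using assms(2) by (simp add: partition_of_unity_of_def)
  define y0 where "y0 = 1 / \<delta>\<^sup>2"
  have y0: "0 < y0"
    using \<delta> by (simp add: y0_def)
  obtain k where k: "0 \<le> k" "k * y0 \<le> F y0" and line: "\<And>y. 0 \<le> y \<Longrightarrow> F y \<le> F y0 + k * (y - y0)"
    using concave_supporting_line[OF assms(12,11,13) y0] by blast
  define a where "a = F y0 - k * y0"
  have a: "0 \<le> a"
    using k by (simp add: a_def)
  have le: "(cmod (\<phi> t))\<^sup>2 \<le> a + k * (cmod (\<psi> t))\<^sup>2" for t
    using line[of "(cmod (\<psi> t))\<^sup>2"] by (simp add: F_eq a_def algebra_simps)
  have dom: "spectral_dom E \<psi> \<subseteq> spectral_dom E \<phi>"
    by (rule spectral_dom_mono[OF sf psi a k(1) le])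

  have upper: "recovery_error \<delta> R ?\<Phi> ?W \<le> ereal (\<delta> * sqrt (F y0))"
  proof -
    let ?g = "recovery_symbol \<phi> \<psi> a k"
    \<comment> \<open>bounded linear operators belong to each of the three classes\<close>
    have "spectral_op E ?g \<in> bounded_operators"
      by (rule bounded_function_bounded_operator[OF sf recovery_symbol_continuous[OF phi psi a k(1)]
            recovery_symbol_bounded[OF a k(1) le]])
    then have T: "spectral_op E ?g \<in> R"
      using assms(16) by (auto simp: all_mappings_def bounded_operators_def linear_operators_def)
    have "norm (?\<Phi> x - spectral_op E ?g \<eta>) \<le> \<delta> * sqrt (F y0)"
      if x: "x \<in> ?W" and \<eta>: "norm (x - \<eta>) \<le> \<delta>" for x \<eta>
    proof (rule power2_le_imp_le)
      have "(norm (?\<Phi> x - spectral_op E ?g \<eta>))\<^sup>2 \<le> k * (norm (?\<Psi> x))\<^sup>2 + a * (norm (x - \<eta>))\<^sup>2"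
        using x by (intro recovery_estimate[OF sf phi psi a k(1) le]) (simp add: W_class_def)
      also have "\<dots> \<le> k * 1\<^sup>2 + a * \<delta>\<^sup>2"
        using x \<eta> by (intro add_mono mult_left_mono power_mono a k) (auto simp: W_class_def)
      also have "\<dots> = \<delta>\<^sup>2 * F y0"
        using \<delta> by (simp add: a_def y0_def field_simps)
      also have "\<dots> = (\<delta> * sqrt (F y0))\<^sup>2"
        using a k y0 by (simp add: power_mult_distrib order_trans[OF mult_nonneg_nonneg k(2)])
      finally show "(norm (?\<Phi> x - spectral_op E ?g \<eta>))\<^sup>2 \<le> (\<delta> * sqrt (F y0))\<^sup>2" .
      show "0 \<le> \<delta> * sqrt (F y0)"
        using \<delta> y0 k by (simp add: order_trans[OF mult_nonneg_nonneg k(2)])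
    qed
    then show ?thesis
      unfolding recovery_error_def by (intro INF_lower2[OF T] SUP_least) auto
  qed

  have middle: "modulus_of_continuity ?\<Phi> ?W \<delta> \<le> recovery_error \<delta> R ?\<Phi> ?W"
  proof (rule modulus_le_recovery_error)
    fix x assume "x \<in> ?W"
    then have x: "x \<in> spectral_dom E \<psi>" "norm (?\<Psi> x) \<le> 1"
      by (simp_all add: W_class_def)
    show "- x \<in> ?W"
      using x spectral_op_minus[OF sf psi x(1)] by (simp add: W_class_def)
    show "?\<Phi> (- x) = - ?\<Phi> x"
      using x dom by (intro spectral_op_minus(2)[OF sf phi]) auto
  qed

  have lower: "ereal (\<delta> * sqrt (F y0)) \<le> modulus_of_continuity ?\<Phi> ?W \<delta>"
  proof -
    have psi_cont: "continuous_on UNIV (\<lambda>t. cmod (\<psi> t))" and phi_cont: "continuous_on UNIV (\<lambda>t. cmod (\<phi> t))"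
      by (intro continuous_intros phi psi)+
    have psi_mono: "cmod (\<psi> s) \<le> cmod (\<psi> t)" and phi_mono: "cmod (\<phi> s) \<le> cmod (\<phi> t)"
      if "0 \<le> s" "s \<le> t" for s t
      using mono_on_nonneg_of_strict_mono_on_pos[OF psi_cont assms(8) that] mono_on_nonneg_of_strict_mono_on_pos[OF phi_cont assms(7) that]
      by auto
    \<comment> \<open>exists because \<open>|\<psi>(0)| \<le> 1 / \<delta>\<close>\<close>
    obtain t0 where t0: "0 \<le> t0" "cmod (\<psi> t0) = 1 / \<delta>"
    proof -
      have "\<forall>\<^sub>F t in at_top. 1 / \<delta> \<le> cmod (\<psi> t)"
        using assms(10) by (auto simp: filterlim_at_top)
      then obtain u where "\<And>t. u \<le> t \<Longrightarrow> 1 / \<delta> \<le> cmod (\<psi> t)"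
        by (auto simp: eventually_at_top_linorder)
      then have "1 / \<delta> \<le> cmod (\<psi> (max 0 u))"
        by simp
      moreover have "cmod (\<psi> 0) \<le> 1 / \<delta>"
        using assms(18) \<delta> by (simp add: field_simps)
      ultimately obtain t0 where "0 \<le> t0" "t0 \<le> max 0 u" "cmod (\<psi> t0) = 1 / \<delta>"
        using IVT'[of "\<lambda>t. cmod (\<psi> t)" 0 "1 / \<delta>" "max 0 u"] continuous_on_subset[OF psi_cont]
        by auto
      then show thesis
        using that by blast
    qed
    have F_t0: "sqrt (F y0) = cmod (\<phi> t0)"
    proof -
      have "y0 = (cmod (\<psi> t0))\<^sup>2"
        by (simp add: t0 y0_def power_divide)
      then show ?thesis
        by (simp flip: F_eq)
    qed
    have ge: "ereal (cmod (\<phi> t0) / cmod (\<psi> t)) \<le> modulus_of_continuity ?\<Phi> ?W \<delta>" if t: "t0 < t" for t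
    proof -
      have psi_t: "1 / \<delta> \<le> cmod (\<psi> t)"
        using psi_mono[of t0 t] t0 t by simp
      then have psi_t_pos: "0 < cmod (\<psi> t)"
        using \<delta> by (auto intro: less_le_trans[OF divide_pos_pos])
      have "(\<lambda>x. E t x - E t0 x) ` spectral_dom E \<psi> \<noteq> {0}"
        using assms(15)[of "ereal t0" "ereal t"] t0 t by (simp add: ext_family_def)
      moreover have "(\<lambda>x. 0) ` spectral_dom E \<psi> = {0}"
        using spectral_dom_zero[OF sf, of \<psi>] by (rule image_constant)
      ultimately obtain z where z: "E t z - E t0 z \<noteq> 0"
        by (metis (no_types, lifting) image_cong)
      define y where "y = E t z - E t0 z"
      \<comment> \<open>scaled to norm \<open>1 / |\<psi>(t)|\<close>, the largest for which \<open>|\<psi>| \<le> |\<psi>(t)|\<close> on \<open>[t\<^sub>0, t)\<close>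
        guarantees \<open>\<parallel>\<psi>(A) x\<parallel> \<le> 1\<close>\<close>
      define x where "x = complex_of_real (1 / (cmod (\<psi> t) * norm y)) *\<^sub>C y"
      have norm_x: "norm x = 1 / cmod (\<psi> t)"
        using z psi_t_pos by (simp add: x_def y_def norm_scaleC norm_divide norm_mult)
      have "E t y - E t0 y = y"
        unfolding y_def using t by (intro increment_idem[OF sf]) simp
      then have "E t x - E t0 x = x"
        unfolding x_def E_scaleC[OF sf] by (simp flip: complex_vector.scale_right_diff_distrib)
      then have conc: "AE r in spectral_measure E x. r \<in> {t0..<t}"
        using t by (intro AE_spectral_interval[OF sf]) auto
      have "AE r in spectral_measure E x. cmod (\<psi> r) \<le> cmod (\<psi> t)"
        using conc by eventually_elim (use t0 in \<open>auto intro: psi_mono\<close>)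
      from bounded_AE_spectral_op[OF sf psi _ this]
      have x: "x \<in> spectral_dom E \<psi>" "norm (?\<Psi> x) \<le> cmod (\<psi> t) * norm x"
        by auto
      have "norm x \<le> \<delta>" and "x \<in> ?W"
        using x psi_t psi_t_pos \<delta> by (auto simp: norm_x W_class_def field_simps)
      have "AE r in spectral_measure E x. cmod (\<phi> t0) \<le> cmod (\<phi> r)"
        using conc by eventually_elim (use t0 in \<open>auto intro: phi_mono\<close>)
      from bounded_below_AE_spectral_op[OF sf phi _ _ this]
      have "cmod (\<phi> t0) * norm x \<le> norm (?\<Phi> x)"
        using x dom by auto
      then have "ereal (cmod (\<phi> t0) / cmod (\<psi> t)) \<le> ereal (norm (?\<Phi> x))"
        by (simp add: norm_x)
      also have "\<dots> \<le> modulus_of_continuity ?\<Phi> ?W \<delta>"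
        unfolding modulus_of_continuity_def using \<open>norm x \<le> \<delta>\<close> \<open>x \<in> ?W\<close> by (intro SUP_upper) simp
      finally show ?thesis .
    qed
    have "isCont (\<lambda>t. cmod (\<psi> t)) t0"
      using psi_cont by (simp add: continuous_on_eq_continuous_at)
    then have "((\<lambda>t. cmod (\<psi> t)) \<longlongrightarrow> cmod (\<psi> t0)) (at_right t0)"
      by (simp add: isCont_def filterlim_at_split)
    then have "((\<lambda>t. ereal (cmod (\<phi> t0) / cmod (\<psi> t))) \<longlongrightarrow> ereal (cmod (\<phi> t0) / cmod (\<psi> t0))) (at_right t0)"
      using t0 \<delta> by (intro tendsto_ereal tendsto_divide tendsto_const) auto
    moreover have "\<forall>\<^sub>F t in at_right t0. ereal (cmod (\<phi> t0) / cmod (\<psi> t)) \<le> modulus_of_continuity ?\<Phi> ?W \<delta>"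
      by (intro eventually_mono[OF eventually_at_right_less ge])
    ultimately have "ereal (cmod (\<phi> t0) / cmod (\<psi> t0)) \<le> modulus_of_continuity ?\<Phi> ?W \<delta>"
      by (intro tendsto_upperbound[of _ _ "at_right t0"]) auto
    then show ?thesis
      by (simp add: F_t0 t0 mult.commute)
  qed

  show ?thesis
    using order_trans[OF lower middle] order_trans[OF middle upper] upper middle lower
    unfolding y0_def by (metis order.antisym)
qed

end
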